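(* Let $R$ and $C$ denote the row and column operator spaces, respectively, and let $\theta,\gamma\in[0,1]$ be distinct. Then the bounded subsets of the interpolation operator space $(R,C)_\theta$ do not almost completely coarsely embed into $(R,C)_\gamma$.
   Context: An operator space is a closed linear subspace $X$ of $\mathcal{B}(H)$ for some complex Hilbert space $H$. For $n\in\mathbb{N}$, $\mathrm{M}_n(X)$ is the space of $n\times n$ matrices over $X$ with the norm inherited from $\mathrm{M}_n(\mathcal{B}(H))\cong\mathcal{B}(H^{\oplus n})$. For a (not necessarily linear) map $f$ defined on a set $A$, its $n$-th amplification $f_n$ is defined on $\mathrm{M}_n(A)$ by $f_n([x_{ij}])=[f(x_{ij})]$. $B_E$ denotes the closed unit ball of a Banach space $E$. A sequence $\bar f=(F^n\colon A_n\to B_n)_n$ of maps between metric spaces $(A_n,d_n)$, $(B_n,\partial_n)$ is an equi-coarse embedding (the maps are equi-coarse embeddings) if $\omega_{\bar f}(t)<\infty$ for all $t\ge 0$ and $\lim_{t\to\infty}\rho_{\bar f}(t)=\infty$, where $\omega_{\bar f}(t)=\sup_n\sup\{\partial_n(F^n(x),F^n(y))\mid d_n(x,y)\le t\}$ and $\rho_{\bar f}(t)=\inf_n\inf\{\partial_n(F^n(x),F^n(y))\mid d_n(x,y)\ge t\}$ (with $\inf\emptyset=\infty$). For operator spaces $X,Y$, the bounded subsets of $X$ almost completely coarsely embed into $Y$ if there is a sequence of maps $(f^n\colon n\cdot B_X\to Y)_n$ such that the restricted amplifications $(f^n_n\restriction_{n\cdot B_{\mathrm{M}_n(X)}}\colon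 n\cdot B_{\mathrm{M}_n(X)}\to\mathrm{M}_n(Y))_{n=1}^\infty$ are equi-coarse embeddings (note $n\cdot B_{\mathrm{M}_n(X)}\subset\mathrm{M}_n(n\cdot B_X)$). Let $e_{i,j}\in\mathcal{B}(\ell_2)$ be the operator whose $(i,j)$-coordinate is $1$ and all others are $0$. Then $R=\overline{\mathrm{span}}\{e_{1,j}\mid j\in\mathbb{N}\}$ and $C=\overline{\mathrm{span}}\{e_{j,1}\mid j\in\mathbb{N}\}$. For $\theta\in[0,1]$, $(R,C)_\theta$ is the complex $\theta$-interpolation space of $R$ and $C$, both regarded as embedded in $\ell_2$ via the canonical linear isometries ($e_{1,j}\mapsto e_j$, $e_{j,1}\mapsto e_j$), with operator space structure given by $\mathrm{M}_n((R,C)_\theta)=(\mathrm{M}_n(R),\mathrm{M}_n(C))_\theta$ for all $n$; in particular $(R,C)_0=R$ and $(R,C)_1=C$ completely isometrically. *)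

theory Defs
  imports
    "HOL-Analysis.Analysis"
    "Jordan_Normal_Form.Matrix"
begin

section \<open>The Hilbert space of square summable sequences\<close>

lemma square_summable_add:
  fixes f g :: "nat \<Rightarrow> complex"
  assumes "summable (\<lambda>k. (cmod (f k))\<^sup>2)" "summable (\<lambda>k. (cmod (g k))\<^sup>2)"
  shows "summable (\<lambda>k. (cmod (f k + g k))\<^sup>2)"
proof (rule summable_comparison_test')
  show "summable (\<lambda>k. 2 * (cmod (f k))\<^sup>2 + 2 * (cmod (g k))\<^sup>2)"
    by (intro summable_add summable_mult assms)
next
  fix k :: nat
  have "(cmod (f k + g k))\<^sup>2 \<le> (cmod (f k) + cmod (g k))\<^sup>2"
    by (intro power_mono norm_triangle_ineq) auto
  also have "\<dots> \<le> 2 * (cmod (f k))\<^sup>2 + 2 * (cmod (g k))\<^sup>2"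
    using sum_squares_bound[of "cmod (f k)" "cmod (g k)"] by (simp add: power2_sum)
  finally show "norm ((cmod (f k + g k))\<^sup>2) \<le> 2 * (cmod (f k))\<^sup>2 + 2 * (cmod (g k))\<^sup>2"
    by simp
qed

lemma square_summable_mult:
  fixes f :: "nat \<Rightarrow> complex"
  assumes "summable (\<lambda>k. (cmod (f k))\<^sup>2)"
  shows "summable (\<lambda>k. (cmod (c * f k))\<^sup>2)"
  using summable_mult[OF assms, of "(cmod c)\<^sup>2"] by (simp add: norm_mult power_mult_distrib)

lemma square_summable_prod:
  fixes f g :: "nat \<Rightarrow> complex"
  assumes "summable (\<lambda>k. (cmod (f k))\<^sup>2)" "summable (\<lambda>k. (cmod (g k))\<^sup>2)"
  shows "summable (\<lambda>k. cmod (f k) * cmod (g k))"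
proof (rule summable_comparison_test')
  show "summable (\<lambda>k. (cmod (f k))\<^sup>2 + (cmod (g k))\<^sup>2)"
    by (intro summable_add assms)
next
  fix k :: nat
  have "0 \<le> cmod (f k) * cmod (g k)" by simp
  with sum_squares_bound[of "cmod (f k)" "cmod (g k)"]
  have "cmod (f k) * cmod (g k) \<le> (cmod (f k))\<^sup>2 + (cmod (g k))\<^sup>2" by linarith
  then show "norm (cmod (f k) * cmod (g k)) \<le> (cmod (f k))\<^sup>2 + (cmod (g k))\<^sup>2"
    by (simp add: abs_mult)
qed

typedef ell2 = "{x :: nat \<Rightarrow> complex. summable (\<lambda>k. (cmod (x k))\<^sup>2)}"
  morphisms coord Abs_ell2
  by (rule exI[of _ "\<lambda>_. 0"]) simp

setup_lifting type_definition_ell2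

instantiation ell2 :: real_inner
begin

lift_definition zero_ell2 :: ell2 is "\<lambda>_. 0" by simp

lift_definition plus_ell2 :: "ell2 \<Rightarrow> ell2 \<Rightarrow> ell2" is "\<lambda>x y k. x k + y k"
  by (rule square_summable_add)

lift_definition uminus_ell2 :: "ell2 \<Rightarrow> ell2" is "\<lambda>x k. - x k" by simp

lift_definition minus_ell2 :: "ell2 \<Rightarrow> ell2 \<Rightarrow> ell2" is "\<lambda>x y k. x k - y k"
  subgoal for x y using square_summable_add[of x "\<lambda>k. - y k"] by simp
  done

lift_definition scaleR_ell2 :: "real \<Rightarrow> ell2 \<Rightarrow> ell2" is "\<lambda>r x k. complex_of_real r * x k"
  by (rule square_summable_mult)

lift_definition inner_ell2 :: "ell2 \<Rightarrow> ell2 \<Rightarrow> real" is "\<lambda>x y. \<Sum>k. inner (x k) (y k)" .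

definition norm_ell2 :: "ell2 \<Rightarrow> real" where "norm_ell2 x = sqrt (inner x x)"

definition dist_ell2 :: "ell2 \<Rightarrow> ell2 \<Rightarrow> real" where "dist_ell2 x y = norm (x - y)"

definition sgn_ell2 :: "ell2 \<Rightarrow> ell2" where "sgn_ell2 x = inverse (norm x) *\<^sub>R x"

definition uniformity_ell2 :: "(ell2 \<times> ell2) filter" where
  "uniformity_ell2 = (INF e\<in>{0<..}. principal {(x, y). dist x y < e})"

definition open_ell2 :: "ell2 set \<Rightarrow> bool" where
  "open_ell2 U \<longleftrightarrow> (\<forall>x\<in>U. \<forall>\<^sub>F (x', y) in uniformity. x' = x \<longrightarrow> y \<in> U)"

lemma summable_inner:
  fixes f g :: "nat \<Rightarrow> complex"
  assumes "summable (\<lambda>k. (cmod (f k))\<^sup>2)" "summable (\<lambda>k. (cmod (g k))\<^sup>2)"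
  shows "summable (\<lambda>k. inner (f k) (g k))"
  by (rule summable_comparison_test'[OF square_summable_prod[OF assms]])
     (simp add: Cauchy_Schwarz_ineq2)

instance
proof
  fix x y z :: ell2 and a b r :: real
  show "x + y + z = x + (y + z)" by transfer (simp add: add.assoc)
  show "x + y = y + x" by transfer (simp add: add.commute)
  show "0 + x = x" by transfer simp
  show "- x + x = 0" by transfer simp
  show "x - y = x + - y" by transfer simp
  show "a *\<^sub>R (x + y) = a *\<^sub>R x + a *\<^sub>R y" by transfer (simp add: algebra_simps)
  show "(a + b) *\<^sub>R x = a *\<^sub>R x + b *\<^sub>R x" by transfer (simp add: algebra_simps)
  show "a *\<^sub>R b *\<^sub>R x = (a * b) *\<^sub>R x" by transfer (simp add: algebra_simps)
  show "1 *\<^sub>R x = x" by transfer simp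
  show "dist x y = norm (x - y)" by (rule dist_ell2_def)
  show "sgn x = inverse (norm x) *\<^sub>R x" by (rule sgn_ell2_def)
  show "uniformity = (INF e\<in>{0<..}. principal {(x::ell2, y). dist x y < e})"
    by (rule uniformity_ell2_def)
  show "open U \<longleftrightarrow> (\<forall>x\<in>U. \<forall>\<^sub>F (x', y) in uniformity. x' = x \<longrightarrow> y \<in> U)" for U :: "ell2 set"
    by (rule open_ell2_def)
  show "inner x y = inner y x" by transfer (simp add: inner_commute)
  show "inner (x + y) z = inner x z + inner y z"
    by transfer (simp add: inner_add_left suminf_add summable_inner)
  show "inner (r *\<^sub>R x) y = r * inner x y"
  proof transfer
    fix r and f g :: "nat \<Rightarrow> complex"
    assume "summable (\<lambda>k. (cmod (f k))\<^sup>2)" "summable (\<lambda>k. (cmod (g k))\<^sup>2)"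
    moreover have "inner (complex_of_real r * f k) (g k) = r * (inner (f k) (g k))" for k
      by (simp add: inner_complex_def algebra_simps)
    ultimately show "(\<Sum>k. inner (complex_of_real r * f k) (g k)) = r * (\<Sum>k. inner (f k) (g k))"
      by (simp add: suminf_mult summable_inner)
  qed
  show "0 \<le> inner x x"
    by transfer (intro suminf_nonneg summable_inner; simp)
  show "inner x x = 0 \<longleftrightarrow> x = 0"
    by transfer (subst suminf_eq_zero_iff; simp add: summable_inner fun_eq_iff)
  show "norm x = sqrt (inner x x)" by (rule norm_ell2_def)
qed

end

lemma norm_ell2_eq: "norm x = sqrt (\<Sum>k. (cmod (coord x k))\<^sup>2)"
  by (simp add: norm_ell2_def inner_ell2.rep_eq dot_square_norm)

lemma cmod_coord_le: "cmod (coord x k) \<le> norm x"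
proof -
  have "summable (\<lambda>k. (cmod (coord x k))\<^sup>2)" using coord[of x] by simp
  then have "(\<Sum>j\<in>{k}. (cmod (coord x j))\<^sup>2) \<le> (\<Sum>j. (cmod (coord x j))\<^sup>2)"
    by (intro sum_le_suminf) auto
  then show ?thesis by (simp add: norm_ell2_eq real_le_rsqrt)
qed

lift_definition scale_ell2 :: "complex \<Rightarrow> ell2 \<Rightarrow> ell2" is "\<lambda>c x k. c * x k"
  by (rule square_summable_mult)

lemma norm_scale_ell2: "norm (scale_ell2 c x) = cmod c * norm x"
proof -
  have "summable (\<lambda>k. (cmod (coord x k))\<^sup>2)" using coord[of x] by simp
  then show ?thesis
    by (simp add: norm_ell2_eq scale_ell2.rep_eq norm_mult power_mult_distrib suminf_mult
        real_sqrt_mult)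
qed

lemma ell2_eqI: "(\<And>k. coord x k = coord y k) \<Longrightarrow> x = y"
  by (simp add: coord_inject[symmetric] fun_eq_iff)

interpretation ell2: vector_space scale_ell2
  by unfold_locales (rule ell2_eqI; simp add: scale_ell2.rep_eq plus_ell2.rep_eq algebra_simps)+

lift_definition basis_ell2 :: "nat \<Rightarrow> ell2" is "\<lambda>j k. if k = j then 1 else 0"
  subgoal for j
    by (rule summable_finite[of "{j}"]) auto
  done

lemma norm_basis_ell2: "norm (basis_ell2 j) = 1"
proof -
  have "(\<Sum>k. (cmod (coord (basis_ell2 j) k))\<^sup>2) = (\<Sum>k\<in>{j}. (cmod (coord (basis_ell2 j) k))\<^sup>2)"
    by (rule suminf_finite) (auto simp: basis_ell2.rep_eq)
  then show ?thesis by (simp add: norm_ell2_eq basis_ell2.rep_eq)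
qed


section \<open>Operators on this space; rows and columns\<close>

text \<open>
  The type \<^typ>\<open>ell2 \<Rightarrow>\<^sub>L ell2\<close> consists of the bounded \<^emph>\<open>real\<close>-linear operators. It contains
  the bounded complex-linear operators as a closed subspace, with the same norm, and every
  operator used below is complex-linear.
\<close>

lemma bounded_linear_scale_ell2: "bounded_linear (scale_ell2 c)"
proof (rule bounded_linear_intro)
  show "norm (scale_ell2 c x) \<le> norm x * cmod c" for x
    by (simp add: norm_scale_ell2)
qed (rule ell2_eqI; simp add: scale_ell2.rep_eq plus_ell2.rep_eq scaleR_ell2.rep_eq
    algebra_simps)+

definition scale_op :: "complex \<Rightarrow> (ell2 \<Rightarrow>\<^sub>L ell2) \<Rightarrow> (ell2 \<Rightarrow>\<^sub>L ell2)" where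
  "scale_op c T = Blinfun (\<lambda>\<xi>. scale_ell2 c (T \<xi>))"

lemma scale_op_apply: "scale_op c T \<xi> = scale_ell2 c (T \<xi>)"
  unfolding scale_op_def
  by (subst bounded_linear_Blinfun_apply)
     (rule bounded_linear_compose[OF bounded_linear_scale_ell2], rule blinfun.bounded_linear_right,
      rule refl)

interpretation op: vector_space scale_op
  by unfold_locales (rule blinfun_eqI; simp add: scale_op_apply blinfun.add_left
    ell2.scale_right_distrib ell2.scale_left_distrib)+

text \<open>Indices start at 0: the matrix unit \<open>e\<^sub>i\<^sub>,\<^sub>j\<close> with \<open>i, j \<ge> 1\<close> is \<open>unit_op (i - 1) (j - 1)\<close>.\<close>

definition unit_op :: "nat \<Rightarrow> nat \<Rightarrow> (ell2 \<Rightarrow>\<^sub>L ell2)" where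
  "unit_op i j = Blinfun (\<lambda>\<xi>. scale_ell2 (coord \<xi> j) (basis_ell2 i))"

lemma unit_op_apply: "unit_op i j \<xi> = scale_ell2 (coord \<xi> j) (basis_ell2 i)"
proof -
  have "bounded_linear (\<lambda>\<xi>. scale_ell2 (coord \<xi> j) (basis_ell2 i))"
  proof (rule bounded_linear_intro)
    show "norm (scale_ell2 (coord x j) (basis_ell2 i)) \<le> norm x * 1" for x
      by (simp add: norm_scale_ell2 norm_basis_ell2 cmod_coord_le)
  qed (rule ell2_eqI; simp add: scale_ell2.rep_eq plus_ell2.rep_eq scaleR_ell2.rep_eq
      algebra_simps)+
  then show ?thesis by (simp add: unit_op_def bounded_linear_Blinfun_apply)
qed

definition row_ops :: "(ell2 \<Rightarrow>\<^sub>L ell2) set" where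
  "row_ops = closure (op.span {unit_op 0 j |j. True})"

definition col_ops :: "(ell2 \<Rightarrow>\<^sub>L ell2) set" where
  "col_ops = closure (op.span {unit_op j 0 |j. True})"

text \<open>
  \<open>row_op\<close> and \<open>col_op\<close> are the inverses of the canonical linear isometries of \<open>R\<close> and \<open>C\<close> onto
  \<open>\<ell>\<^sub>2\<close>, that is, \<open>e\<^sub>j \<mapsto> e\<^sub>1\<^sub>,\<^sub>j\<close> and \<open>e\<^sub>j \<mapsto> e\<^sub>j\<^sub>,\<^sub>1\<close>. No conjugation occurs in \<open>row_op\<close>: it is complex-linear.
\<close>

definition row_op :: "ell2 \<Rightarrow> (ell2 \<Rightarrow>\<^sub>L ell2)" where
  "row_op x = Blinfun (\<lambda>\<xi>. scale_ell2 (\<Sum>k. coord x k * coord \<xi> k) (basis_ell2 0))"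

definition col_op :: "ell2 \<Rightarrow> (ell2 \<Rightarrow>\<^sub>L ell2)" where
  "col_op x = Blinfun (\<lambda>\<xi>. scale_ell2 (coord \<xi> 0) x)"

lemma square_summable_coord: "summable (\<lambda>k. (cmod (coord x k))\<^sup>2)"
  using coord[of x] by simp

lemma summable_coord_mult: "summable (\<lambda>k. coord x k * coord y k)"
  by (rule summable_norm_cancel)
     (simp add: norm_mult square_summable_prod square_summable_coord)

lemma cmod_pairing_le: "cmod (\<Sum>k. coord x k * coord y k) \<le> norm x * norm y"
proof -
  define m where "m z = Abs_ell2 (\<lambda>k. complex_of_real (cmod (coord z k)))" for z
  have m: "coord (m z) = (\<lambda>k. complex_of_real (cmod (coord z k)))" for z
    unfolding m_def by (rule Abs_ell2_inverse) (simp add: square_summable_coord)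
  have nm: "norm (m z) = norm z" for z by (simp add: norm_ell2_eq m)
  have "cmod (\<Sum>k. coord x k * coord y k) \<le> (\<Sum>k. cmod (coord x k * coord y k))"
    by (rule summable_norm)
       (simp add: norm_mult square_summable_prod square_summable_coord)
  also have "\<dots> = inner (m x) (m y)"
    by (simp add: inner_ell2.rep_eq m inner_complex_def norm_mult)
  also have "\<dots> \<le> norm x * norm y"
    using norm_cauchy_schwarz[of "m x" "m y"] by (simp add: nm)
  finally show ?thesis .
qed

lemma row_op_apply: "row_op x \<xi> = scale_ell2 (\<Sum>k. coord x k * coord \<xi> k) (basis_ell2 0)"
proof -
  have "bounded_linear (\<lambda>\<xi>. scale_ell2 (\<Sum>k. coord x k * coord \<xi> k) (basis_ell2 0))"
  proof (rule bounded_linear_intro)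
    fix y z :: ell2 and r :: real
    show "norm (scale_ell2 (\<Sum>k. coord x k * coord y k) (basis_ell2 0)) \<le> norm y * norm x"
      by (simp add: norm_scale_ell2 norm_basis_ell2) (metis cmod_pairing_le mult.commute)
    have "(\<Sum>k. coord x k * coord (y + z) k)
        = (\<Sum>k. coord x k * coord y k) + (\<Sum>k. coord x k * coord z k)"
      by (simp add: plus_ell2.rep_eq distrib_left suminf_add summable_coord_mult)
    then show "scale_ell2 (\<Sum>k. coord x k * coord (y + z) k) (basis_ell2 0)
        = scale_ell2 (\<Sum>k. coord x k * coord y k) (basis_ell2 0)
          + scale_ell2 (\<Sum>k. coord x k * coord z k) (basis_ell2 0)"
      by (simp add: ell2.scale_left_distrib)
    have "(\<Sum>k. coord x k * coord (r *\<^sub>R y) k)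
        = (\<Sum>k. complex_of_real r * (coord x k * coord y k))"
      by (simp add: scaleR_ell2.rep_eq mult.left_commute)
    also have "\<dots> = complex_of_real r * (\<Sum>k. coord x k * coord y k)"
      by (rule suminf_mult[OF summable_coord_mult])
    finally show "scale_ell2 (\<Sum>k. coord x k * coord (r *\<^sub>R y) k) (basis_ell2 0)
        = r *\<^sub>R scale_ell2 (\<Sum>k. coord x k * coord y k) (basis_ell2 0)"
      by (intro ell2_eqI) (simp add: scale_ell2.rep_eq scaleR_ell2.rep_eq)
  qed
  then show ?thesis by (simp add: row_op_def bounded_linear_Blinfun_apply)
qed

lemma col_op_apply: "col_op x \<xi> = scale_ell2 (coord \<xi> 0) x"
proof -
  have "bounded_linear (\<lambda>\<xi>. scale_ell2 (coord \<xi> 0) x)"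
  proof (rule bounded_linear_intro)
    show "norm (scale_ell2 (coord y 0) x) \<le> norm y * norm x" for y
      by (simp add: norm_scale_ell2 cmod_coord_le mult_right_mono)
  qed (rule ell2_eqI; simp add: scale_ell2.rep_eq plus_ell2.rep_eq scaleR_ell2.rep_eq
      algebra_simps)+
  then show ?thesis by (simp add: col_op_def bounded_linear_Blinfun_apply)
qed

lemma row_op_basis: "row_op (basis_ell2 j) = unit_op 0 j"
proof (rule blinfun_eqI)
  fix \<xi>
  have "(\<Sum>k. coord (basis_ell2 j) k * coord \<xi> k)
      = (\<Sum>k\<in>{j}. coord (basis_ell2 j) k * coord \<xi> k)"
    by (rule suminf_finite) (auto simp: basis_ell2.rep_eq)
  then show "row_op (basis_ell2 j) \<xi> = unit_op 0 j \<xi>"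
    by (simp add: row_op_apply unit_op_apply basis_ell2.rep_eq)
qed

lemma col_op_basis: "col_op (basis_ell2 j) = unit_op j 0"
  by (rule blinfun_eqI) (simp add: col_op_apply unit_op_apply)

lemma norm_row_op: "norm (row_op x) = norm x"
proof (rule antisym)
  show "norm (row_op x) \<le> norm x"
    by (rule norm_blinfun_bound)
       (simp_all add: row_op_apply norm_scale_ell2 norm_basis_ell2 cmod_pairing_le)
  define y where "y = Abs_ell2 (\<lambda>k. cnj (coord x k))"
  have y: "coord y = (\<lambda>k. cnj (coord x k))"
    unfolding y_def by (rule Abs_ell2_inverse) (simp add: square_summable_coord)
  have ny: "norm y = norm x" by (simp add: norm_ell2_eq y)
  have nx: "(norm x)\<^sup>2 = (\<Sum>k. (cmod (coord x k))\<^sup>2)"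
    by (simp add: norm_ell2_eq suminf_nonneg square_summable_coord)
  have "(\<Sum>k. coord x k * coord y k) = (\<Sum>k. complex_of_real ((cmod (coord x k))\<^sup>2))"
    by (simp only: y complex_norm_square)
  also have "\<dots> = complex_of_real ((norm x)\<^sup>2)"
    by (simp only: nx suminf_of_real[OF square_summable_coord])
  finally have "norm (row_op x y) = (norm x)\<^sup>2"
    by (simp add: row_op_apply norm_scale_ell2 norm_basis_ell2 norm_power)
  with norm_blinfun[of "row_op x" y] show "norm x \<le> norm (row_op x)"
    by (cases "norm x = 0") (simp_all add: ny power2_eq_square)
qed

lemma norm_col_op: "norm (col_op x) = norm x"
proof (rule antisym)
  show "norm (col_op x) \<le> norm x"
    by (rule norm_blinfun_bound)
       (simp_all add: col_op_apply norm_scale_ell2 cmod_coord_le mult_right_mono mult.commute[of "norm x"])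
  show "norm x \<le> norm (col_op x)"
    using norm_blinfun[of "col_op x" "basis_ell2 0"]
    by (simp add: col_op_apply norm_basis_ell2 basis_ell2.rep_eq)
qed

text \<open>The norm of an \<open>n \<times> n\<close> matrix of operators acting on the \<open>n\<close>-fold Hilbert sum of \<open>\<ell>\<^sub>2\<close>.\<close>

definition op_mat_norm :: "(ell2 \<Rightarrow>\<^sub>L ell2) mat \<Rightarrow> real" where
  "op_mat_norm A = Sup {L2_set (\<lambda>i. norm (\<Sum>j<dim_col A. blinfun_apply (A $$ (i, j)) (\<xi> j))) {..<dim_row A}
     |\<xi>. L2_set (\<lambda>j. norm (\<xi> j)) {..<dim_col A} \<le> 1}"


section \<open>Operator spaces\<close>

text \<open>
  An \<open>opspace\<close> is a set \<open>elems\<close> of vectors together with norms on the square matrices over it.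
  Only the square matrices with entries in \<open>elems\<close> are meaningful arguments of \<open>mnrm\<close>.
\<close>

record 'v nspace =
  carr :: "'v set"
  nrm :: "'v \<Rightarrow> real"

record 'v opspace =
  elems :: "'v set"
  mnrm :: "'v mat \<Rightarrow> real"

definition Mn :: "nat \<Rightarrow> 'v opspace \<Rightarrow> 'v mat nspace" where
  "Mn n X = \<lparr>carr = {A \<in> carrier_mat n n. elements_mat A \<subseteq> elems X}, nrm = mnrm X\<rparr>"

definition ground :: "'v opspace \<Rightarrow> 'v nspace" where
  "ground X = \<lparr>carr = elems X, nrm = (\<lambda>x. mnrm X (Matrix.mat 1 1 (\<lambda>_. x)))\<rparr>"

text \<open>\<open>R\<close> and \<open>C\<close>, transported to \<open>\<ell>\<^sub>2\<close> along the canonical isometries.\<close>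

definition row_space :: "ell2 opspace" where
  "row_space = \<lparr>elems = {x. row_op x \<in> row_ops}, mnrm = (\<lambda>A. op_mat_norm (map_mat row_op A))\<rparr>"

definition col_space :: "ell2 opspace" where
  "col_space = \<lparr>elems = {x. col_op x \<in> col_ops}, mnrm = (\<lambda>A. op_mat_norm (map_mat col_op A))\<rparr>"


section \<open>Complex interpolation\<close>

text \<open>
  Calderon's method for two normed spaces \<open>X\<close>, \<open>Y\<close> inside a common complex vector space, whose
  scalar multiplication is the argument \<open>sc\<close>. The ambient type only carries addition and
  subtraction, so that it can be a type of matrices, where these are meaningful for matching
  dimensions.
\<close>

definition sum_space :: "'v::{plus,minus} nspace \<Rightarrow> 'v nspace \<Rightarrow> 'v nspace" where
  "sum_space X Y =
     \<lparr>carr = {a + b |a b. a \<in> carr X \<and> b \<in> carr Y},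
      nrm = (\<lambda>v. Inf {nrm X a + nrm Y b |a b. a \<in> carr X \<and> b \<in> carr Y \<and> v = a + b})\<rparr>"

definition nlim :: "'v::{plus,minus} nspace \<Rightarrow> ('c \<Rightarrow> 'v) \<Rightarrow> 'v \<Rightarrow> 'c filter \<Rightarrow> bool" where
  "nlim X f l F \<longleftrightarrow> ((\<lambda>w. nrm X (f w - l)) \<longlongrightarrow> 0) F"

definition strip :: "complex set" where
  "strip = {z. 0 \<le> Re z \<and> Re z \<le> 1}"

definition calderon ::
    "(complex \<Rightarrow> 'v::{plus,minus} \<Rightarrow> 'v) \<Rightarrow> 'v nspace \<Rightarrow> 'v nspace \<Rightarrow> (complex \<Rightarrow> 'v) set" where
  "calderon sc X Y = {f.
     (\<forall>z\<in>strip. f z \<in> carr (sum_space X Y)) \<and>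
     (\<exists>B. \<forall>z\<in>strip. nrm (sum_space X Y) (f z) \<le> B) \<and>
     (\<forall>z\<in>strip. nlim (sum_space X Y) f (f z) (at z within strip)) \<and>
     (\<forall>z\<in>interior strip. \<exists>D\<in>carr (sum_space X Y).
        nlim (sum_space X Y) (\<lambda>w. sc (1 / (w - z)) (f w - f z)) D (at z)) \<and>
     (\<forall>t::real. f (\<i> * t) \<in> carr X \<and> f (1 + \<i> * t) \<in> carr Y) \<and>
     (\<forall>t::real. nlim X (\<lambda>s::real. f (\<i> * s)) (f (\<i> * t)) (at t)) \<and>
     (\<forall>t::real. nlim Y (\<lambda>s::real. f (1 + \<i> * s)) (f (1 + \<i> * t)) (at t)) \<and>
     ((\<lambda>t::real. nrm X (f (\<i> * t))) \<longlongrightarrow> 0) at_infinity \<and>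
     ((\<lambda>t::real. nrm Y (f (1 + \<i> * t))) \<longlongrightarrow> 0) at_infinity}"

definition calderon_norm :: "'v nspace \<Rightarrow> 'v nspace \<Rightarrow> (complex \<Rightarrow> 'v) \<Rightarrow> real" where
  "calderon_norm X Y f =
     max (SUP t::real. nrm X (f (\<i> * t))) (SUP t::real. nrm Y (f (1 + \<i> * t)))"

text \<open>
  The parameter \<open>\<theta>\<close> ranges over \<open>[0,1]\<close>. At the end points, for \<open>x\<close> in both spaces, the functions
  \<open>z \<mapsto> exp (\<delta> * z\<^sup>2 - \<lambda> * z) x\<close> with \<open>\<delta> > 0\<close> and \<open>\<lambda>\<close> large (and their reflections in \<open>z \<mapsto> 1 - z\<close>)
  show that the norm is that of \<open>X\<close> for \<open>\<theta> = 0\<close> and that of \<open>Y\<close> for \<open>\<theta> = 1\<close>.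
\<close>

definition interp ::
    "(complex \<Rightarrow> 'v::{plus,minus} \<Rightarrow> 'v) \<Rightarrow> 'v nspace \<Rightarrow> 'v nspace \<Rightarrow> real \<Rightarrow> 'v nspace" where
  "interp sc X Y \<theta> =
     \<lparr>carr = {f (complex_of_real \<theta>) |f. f \<in> calderon sc X Y},
      nrm = (\<lambda>v. Inf {calderon_norm X Y f |f. f \<in> calderon sc X Y \<and> f (complex_of_real \<theta>) = v})\<rparr>"

definition interp_opspace ::
    "(complex \<Rightarrow> 'v::{plus,minus} \<Rightarrow> 'v) \<Rightarrow> 'v opspace \<Rightarrow> 'v opspace \<Rightarrow> real \<Rightarrow> 'v opspace" where
  "interp_opspace sc X Y \<theta> =
     \<lparr>elems = carr (interp sc (ground X) (ground Y) \<theta>),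
      mnrm = (\<lambda>A. nrm (interp (\<lambda>c. map_mat (sc c)) (Mn (dim_row A) X) (Mn (dim_row A) Y) \<theta>) A)\<rparr>"

definition RC :: "real \<Rightarrow> ell2 opspace" where
  "RC \<theta> = interp_opspace scale_ell2 row_space col_space \<theta>"


section \<open>Coarse embeddings\<close>

text \<open>
  Sequences are indexed by \<open>n \<ge> 1\<close>. Moduli take values in \<^typ>\<open>ennreal\<close>, where the supremum over the empty set
  is \<open>0\<close> and the infimum over the empty set is \<open>\<infinity>\<close>.
\<close>

definition expansion_modulus ::
    "(nat \<Rightarrow> 'a set) \<Rightarrow> (nat \<Rightarrow> 'a \<Rightarrow> 'a \<Rightarrow> real) \<Rightarrow> (nat \<Rightarrow> 'b \<Rightarrow> 'b \<Rightarrow> real) \<Rightarrow> (nat \<Rightarrow> 'a \<Rightarrow> 'b)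
      \<Rightarrow> real \<Rightarrow> ennreal" where
  "expansion_modulus A d d' F t =
     (SUP n\<in>{1..}. Sup {ennreal (d' n (F n x) (F n y)) |x y. x \<in> A n \<and> y \<in> A n \<and> d n x y \<le> t})"

definition compression_modulus ::
    "(nat \<Rightarrow> 'a set) \<Rightarrow> (nat \<Rightarrow> 'a \<Rightarrow> 'a \<Rightarrow> real) \<Rightarrow> (nat \<Rightarrow> 'b \<Rightarrow> 'b \<Rightarrow> real) \<Rightarrow> (nat \<Rightarrow> 'a \<Rightarrow> 'b)
      \<Rightarrow> real \<Rightarrow> ennreal" where
  "compression_modulus A d d' F t =
     (INF n\<in>{1..}. Inf {ennreal (d' n (F n x) (F n y)) |x y. x \<in> A n \<and> y \<in> A n \<and> d n x y \<ge> t})"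

definition equi_coarse_embedding ::
    "(nat \<Rightarrow> 'a set) \<Rightarrow> (nat \<Rightarrow> 'a \<Rightarrow> 'a \<Rightarrow> real) \<Rightarrow> (nat \<Rightarrow> 'b set) \<Rightarrow> (nat \<Rightarrow> 'b \<Rightarrow> 'b \<Rightarrow> real)
      \<Rightarrow> (nat \<Rightarrow> 'a \<Rightarrow> 'b) \<Rightarrow> bool" where
  "equi_coarse_embedding A d B d' F \<longleftrightarrow>
     (\<forall>n\<ge>1. F n \<in> A n \<rightarrow> B n) \<and>
     (\<forall>t\<ge>0. expansion_modulus A d d' F t < \<infinity>) \<and>
     (compression_modulus A d d' F \<longlongrightarrow> \<infinity>) at_top"

definition ndist :: "'v::minus nspace \<Rightarrow> 'v \<Rightarrow> 'v \<Rightarrow> real" where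
  "ndist X x y = nrm X (x - y)"

definition closed_ball :: "'v nspace \<Rightarrow> real \<Rightarrow> 'v set" where
  "closed_ball X r = {x \<in> carr X. nrm X x \<le> r}"

text \<open>The \<open>n\<close>-th amplification of \<open>f\<close> is \<open>map_mat f\<close> on \<open>n \<times> n\<close> matrices.\<close>

definition bounded_subsets_almost_completely_coarsely_embed ::
    "'a::minus opspace \<Rightarrow> 'b::minus opspace \<Rightarrow> bool" where
  "bounded_subsets_almost_completely_coarsely_embed X Y \<longleftrightarrow>
     (\<exists>f :: nat \<Rightarrow> 'a \<Rightarrow> 'b.
        (\<forall>n\<ge>1. f n \<in> closed_ball (ground X) (real n) \<rightarrow> elems Y) \<and>
        equi_coarse_embedding
          (\<lambda>n. closed_ball (Mn n X) (real n)) (\<lambda>n. ndist (Mn n X))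
          (\<lambda>n. carr (Mn n Y)) (\<lambda>n. ndist (Mn n Y))
          (\<lambda>n. map_mat (f n)))"

end

theory Submission
  imports Defs "HOL-Complex_Analysis.Complex_Analysis" "HOL-Real_Asymp.Real_Asymp"
begin

text \<open>
  Why \<open>(R,C)\<^sub>\<theta>\<close> does not embed into \<open>(R,C)\<^sub>\<gamma>\<close>: the two spaces assign norms of different order to
  long rows and columns. The \<open>n \<times> n\<close> matrix whose first row is \<open>e\<^sub>1, \<dots>, e\<^sub>n\<close> and whose other entries
  vanish has norm \<open>sqrt n\<close> over \<open>R\<close> and norm 1 over \<open>C\<close>. By interpolation its norm over \<open>(R,C)\<^sub>\<theta>\<close>
  is of order \<open>n powr ((1 - \<theta>) / 2)\<close>; for the first column the exponent is \<open>\<theta> / 2\<close>. Conversely,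
  over \<open>(R,C)\<^sub>\<gamma>\<close> a row of \<open>n\<close> arbitrary vectors of norm at least 1 has norm at least a multiple
  of \<open>n powr ((1 - \<gamma>) / 2)\<close>, and a column at least a multiple of \<open>n powr (\<gamma> / 2)\<close>.

  Let \<open>\<gamma> < \<theta>\<close> and let \<open>f\<^sub>n\<close> be the maps of an almost complete coarse embedding. For a large
  constant \<open>L\<close>, the vectors \<open>f\<^sub>n (L e\<^sub>j) - f\<^sub>n 0\<close> have norm at least 1, so the amplification of \<open>f\<^sub>n\<close>
  moves the row of the \<open>L e\<^sub>j\<close> at least \<open>n powr ((1 - \<gamma>) / 2)\<close> away from the image of 0, up to a constant. But the
  segment from 0 to this row has length of order \<open>n powr ((1 - \<theta>) / 2)\<close> and stays in the ball of
  radius \<open>n\<close>; cutting it into steps of length at most 1, each of which is mapped to a step of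
  bounded length, bounds the same distance by a multiple of the smaller power
  \<open>n powr ((1 - \<theta>) / 2)\<close>. If \<open>\<theta> < \<gamma>\<close>, columns give the same contradiction. The lemma
  \<open>no_embedding_if_lines_stretch\<close> carries out this argument for both cases.

  The norm estimates rest on two facts about complex interpolation. An explicit function in the
  Calderon space bounds the norm of a vector from above (\<open>nrm_interp_le\<close>). From below, the three
  lines theorem interpolates the norm of a linear functional (\<open>functional_le_nrm_interp\<close>); the
  functionals used pair each entry on the line with a unit vector. The telescoping argument is
  carried out with such a functional instead of the norm, which avoids the triangle inequality for
  the interpolated norm.
\<close>

section \<open>The three lines theorem\<close>

text \<open>
  The factor \<open>exp (\<epsilon> * (z\<^sup>2 - 1))\<close> has modulus at most 1 on the strip and tends to 0 as
  \<open>\<bar>Im z\<bar>\<close> grows, so the product with \<open>h\<close> is small on the horizontal sides of a long rectangle and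
  the maximum modulus principle applies there. Then \<open>\<epsilon>\<close> tends to 0.
\<close>

lemma three_lines:
  fixes h :: "complex \<Rightarrow> complex"
  assumes cont: "continuous_on strip h" and holo: "h holomorphic_on interior strip"
    and bdd: "\<And>z. z \<in> strip \<Longrightarrow> cmod (h z) \<le> B"
    and edge: "\<And>z. Re z = 0 \<or> Re z = 1 \<Longrightarrow> cmod (h z) \<le> N"
    and z: "z \<in> strip"
  shows "cmod (h z) \<le> N"
proof -
  have damped: "exp (\<epsilon> * ((Re z)\<^sup>2 - (Im z)\<^sup>2 - 1)) * cmod (h z) \<le> N + \<epsilon>" if "\<epsilon> > 0" for \<epsilon> :: real
  proof -
    define g where "g w = exp (of_real \<epsilon> * (w\<^sup>2 - 1)) * h w" for w :: complex
    have cmod_g: "cmod (g w) = exp (\<epsilon> * ((Re w)\<^sup>2 - (Im w)\<^sup>2 - 1)) * cmod (h w)" for w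
      by (simp add: g_def norm_mult Re_power2)
    have "((\<lambda>T. B * exp (- \<epsilon> * T\<^sup>2)) \<longlongrightarrow> 0) at_top" using that by real_asymp
    then have "\<forall>\<^sub>F T in at_top. B * exp (- \<epsilon> * T\<^sup>2) < \<epsilon>" by (rule order_tendstoD(2)) fact
    then obtain T where T: "B * exp (- \<epsilon> * T\<^sup>2) < \<epsilon>" "T > \<bar>Im z\<bar>"
      using eventually_happens[OF eventually_conj[OF _ eventually_gt_at_top[of "\<bar>Im z\<bar>"]]] by force
    define S where "S = cbox (Complex 0 (- T)) (Complex 1 T)"
    have S: "S \<subseteq> strip" by (auto simp: S_def strip_def in_cbox_complex_iff)
    have N: "N \<ge> 0" using order_trans[OF norm_ge_zero edge[of 0]] by simp
    have B: "B \<ge> 0" using bdd[OF z] norm_ge_zero[of "h z"] by linarith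
    have "cmod (g z) \<le> N + \<epsilon>"
    proof (rule maximum_modulus_frontier[of g S])
      show "g holomorphic_on interior S" unfolding g_def
        by (intro holomorphic_intros holomorphic_on_subset[OF holo] interior_mono S)
      show "continuous_on (closure S) g" unfolding g_def
        using S by (intro continuous_intros continuous_on_subset[OF cont]) (auto simp: S_def)
      show "bounded S" by (simp add: S_def)
      show "z \<in> S" using z T by (auto simp: S_def in_cbox_complex_iff strip_def)
    next
      fix w assume "w \<in> frontier S"
      then have w: "w \<in> S" "Re w = 0 \<or> Re w = 1 \<or> \<bar>Im w\<bar> = T"
        by (auto simp: S_def frontier_cbox in_cbox_complex_iff in_box_complex_iff)
      then have sq: "(Re w)\<^sup>2 \<le> 1"
        by (auto simp: S_def in_cbox_complex_iff intro: power_le_one)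
      show "cmod (g w) \<le> N + \<epsilon>"
      proof (cases "\<bar>Im w\<bar> = T")
        case True
        then have "(Im w)\<^sup>2 = T\<^sup>2" by (metis power2_abs)
        then have "\<epsilon> * ((Re w)\<^sup>2 - (Im w)\<^sup>2 - 1) \<le> - \<epsilon> * T\<^sup>2"
          using sq that by (simp add: algebra_simps)
        then have "cmod (g w) \<le> exp (- \<epsilon> * T\<^sup>2) * B"
          unfolding cmod_g using S w B by (intro mult_mono bdd) auto
        then show ?thesis using T N by (simp add: mult.commute)
      next
        case False
        then have "cmod (h w) \<le> N" using w edge by blast
        moreover have "exp (\<epsilon> * ((Re w)\<^sup>2 - (Im w)\<^sup>2 - 1)) \<le> 1"
          using sq that zero_le_power2[of "Im w"]
          by (simp only: exp_le_one_iff) (intro mult_nonneg_nonpos; linarith)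
        ultimately have "cmod (g w) \<le> 1 * N"
          unfolding cmod_g by (intro mult_mono) auto
        then show ?thesis using that by simp
      qed
    qed
    then show ?thesis by (simp add: cmod_g)
  qed
  define q where "q = (Re z)\<^sup>2 - (Im z)\<^sup>2 - 1"
  have "((\<lambda>\<epsilon>. exp (\<epsilon> * q) * cmod (h z)) \<longlongrightarrow> exp (0 * q) * cmod (h z)) (at_right 0)"
    by (intro tendsto_intros)
  moreover have "((\<lambda>\<epsilon>. N + \<epsilon>) \<longlongrightarrow> N + 0) (at_right 0)" by (intro tendsto_intros)
  moreover have "\<forall>\<^sub>F \<epsilon> in at_right 0. exp (\<epsilon> * q) * cmod (h z) \<le> N + \<epsilon>"
    using damped by (auto simp: eventually_at_right_less q_def intro: eventually_mono[OF eventually_at_right_less])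
  ultimately show ?thesis using tendsto_le[OF trivial_limit_at_right_real] by fastforce
qed

section \<open>Two-sided estimates for interpolation norms\<close>

text \<open>
  The ambient types of the interpolation construction (such as matrices of all sizes) carry only
  addition and subtraction, without the group laws. This locale lists the laws that hold on the
  carrier. Homogeneity is an inequality: applied to \<open>c\<close> and to \<open>1 / c\<close> it gives the equality.
\<close>

locale seminormed_space =
  fixes sc :: "complex \<Rightarrow> 'v::{plus,minus} \<Rightarrow> 'v" and V :: "'v set" and X :: "'v nspace"
  assumes carr: "carr X = V"
    and add_mem: "v \<in> V \<Longrightarrow> w \<in> V \<Longrightarrow> v + w \<in> V"
    and diff_mem: "v \<in> V \<Longrightarrow> w \<in> V \<Longrightarrow> v - w \<in> V"
    and scale_mem: "v \<in> V \<Longrightarrow> sc c v \<in> V"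
    and diff_add: "v \<in> V \<Longrightarrow> w \<in> V \<Longrightarrow> (v - w) + w = v"
    and diff_flip: "v \<in> V \<Longrightarrow> w \<in> V \<Longrightarrow> w - v = sc (- 1) (v - w)"
    and add_zero: "v \<in> V \<Longrightarrow> v + sc 0 v = v"
    and scale_diff: "v \<in> V \<Longrightarrow> sc a v - sc b v = sc (a - b) v"
    and scale_scale: "v \<in> V \<Longrightarrow> sc a (sc b v) = sc (a * b) v"
    and scale_one: "v \<in> V \<Longrightarrow> sc 1 v = v"
    and nonneg: "v \<in> V \<Longrightarrow> 0 \<le> nrm X v"
    and scale_le: "v \<in> V \<Longrightarrow> nrm X (sc c v) \<le> cmod c * nrm X v"
    and triangle: "v \<in> V \<Longrightarrow> w \<in> V \<Longrightarrow> nrm X (v + w) \<le> nrm X v + nrm X w"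
begin

lemma nrm_diff_ge:
  assumes "v \<in> V" "w \<in> V" shows "\<bar>nrm X v - nrm X w\<bar> \<le> nrm X (v - w)"
proof -
  have 1: "nrm X v \<le> nrm X (v - w) + nrm X w" if "v \<in> V" "w \<in> V" for v w
    using triangle[OF diff_mem[OF that] that(2)] diff_add[OF that] by simp
  have "nrm X (w - v) \<le> nrm X (v - w)"
    using scale_le[OF diff_mem[OF assms], of "- 1"] diff_flip[OF assms] by simp
  then show ?thesis using 1[OF assms] 1[OF assms(2,1)] by linarith
qed

text \<open>
  \<open>calderon_norm\<close> contains suprema of real numbers over the two boundary lines, which say nothing
  unless the sets are bounded. Boundedness comes from continuity together with the decay at infinity.
\<close>

lemma nrm_bounded_of_vanishing:
  fixes f :: "real \<Rightarrow> 'v"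
  assumes f: "\<And>t. f t \<in> V" and lim: "\<And>t. nlim X f (f t) (at t)"
    and van: "((\<lambda>t. nrm X (f t)) \<longlongrightarrow> 0) at_infinity"
  shows "bdd_above (range (\<lambda>t. nrm X (f t)))"
proof -
  have "isCont (\<lambda>t. nrm X (f t)) t" for t
  proof -
    have "((\<lambda>s. nrm X (f s) - nrm X (f t)) \<longlongrightarrow> 0) (at t)"
      by (rule Lim_null_comparison[OF _ lim[unfolded nlim_def]])
        (simp add: nrm_diff_ge f)
    then show ?thesis by (simp add: isCont_def LIM_zero_cancel)
  qed
  then have cont: "continuous_on S (\<lambda>t. nrm X (f t))" for S
    by (simp add: continuous_at_imp_continuous_on)
  have "\<forall>\<^sub>F t in at_infinity. nrm X (f t) < 1"
    by (rule order_tendstoD(2)[OF van]) simp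
  then obtain T where T: "\<And>t. \<bar>t\<bar> \<ge> T \<Longrightarrow> nrm X (f t) < 1"
    by (auto simp: eventually_at_infinity)
  have "bounded ((\<lambda>t. nrm X (f t)) ` {- T..T})"
    by (intro compact_imp_bounded compact_continuous_image cont) simp
  then obtain B where B: "\<And>t. t \<in> {- T..T} \<Longrightarrow> \<bar>nrm X (f t)\<bar> \<le> B"
    unfolding bounded_iff by (metis image_eqI real_norm_def)
  have "nrm X (f t) \<le> max 1 B" for t
    using T[of t] B[of t] by (cases "\<bar>t\<bar> \<ge> T") (auto simp: abs_if split: if_splits)
  then show ?thesis by (intro bdd_aboveI2)
qed

end

text \<open>
  Both norms of the couple live on the same carrier, so the sum space has this carrier as well.
\<close>

locale couple = X: seminormed_space sc V X + Y: seminormed_space sc V Y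
  for sc :: "complex \<Rightarrow> 'v::{plus,minus} \<Rightarrow> 'v" and V X Y
begin

lemma carr_sum: "carr (sum_space X Y) = V"
proof -
  have "\<exists>a b. v = a + b \<and> a \<in> V \<and> b \<in> V" if "v \<in> V" for v
    using that by (intro exI[of _ v] exI[of _ "sc 0 v"]) (simp add: X.add_zero X.scale_mem)
  then show ?thesis by (auto simp: sum_space_def X.carr Y.carr X.add_mem)
qed

lemma nrm_sum_greatest:
  assumes "v \<in> V" "\<And>a b. a \<in> V \<Longrightarrow> b \<in> V \<Longrightarrow> v = a + b \<Longrightarrow> C \<le> nrm X a + nrm Y b"
  shows "C \<le> nrm (sum_space X Y) v"
proof -
  have "v = v + sc 0 v" "sc 0 v \<in> V" using assms X.add_zero X.scale_mem by auto
  then show ?thesis using assms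
    by (auto simp: sum_space_def X.carr Y.carr intro!: cInf_greatest)
qed

lemma nrm_sum_nonneg: "v \<in> V \<Longrightarrow> 0 \<le> nrm (sum_space X Y) v"
  by (rule nrm_sum_greatest) (auto simp: X.nonneg Y.nonneg)

lemma nrm_sum_le:
  assumes "v \<in> V" shows "nrm (sum_space X Y) v \<le> nrm X v"
proof -
  have "nrm Y (sc 0 v) = 0"
    using Y.scale_le[OF assms, of 0] Y.nonneg[OF Y.scale_mem[OF assms, of 0]] by simp
  then show ?thesis unfolding sum_space_def nspace.simps X.carr Y.carr
    using assms X.add_zero[OF assms] X.scale_mem[OF assms]
    by (intro cInf_lower2[of "nrm X v + nrm Y (sc 0 v)"] bdd_belowI[of _ 0])
      (force simp: X.nonneg Y.nonneg)+
qed

lemma nrm_sum_scale_tendsto: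
  assumes "v \<in> V" "((\<lambda>x. cmod (g x)) \<longlongrightarrow> 0) F"
  shows "((\<lambda>x. nrm (sum_space X Y) (sc (g x) v)) \<longlongrightarrow> 0) F"
proof (rule Lim_null_comparison)
  show "((\<lambda>x. cmod (g x) * nrm X v) \<longlongrightarrow> 0) F"
    using tendsto_mult_right[OF assms(2), of "nrm X v"] by simp
  show "\<forall>\<^sub>F x in F. norm (nrm (sum_space X Y) (sc (g x) v)) \<le> cmod (g x) * nrm X v"
    using order_trans[OF nrm_sum_le X.scale_le] assms nrm_sum_nonneg X.scale_mem
    by (intro always_eventually) simp
qed

text \<open>
  All upper bounds for interpolation norms below come from functions with one-dimensional range.
\<close>

lemma scalar_multiple_in_calderon:
  assumes v: "v \<in> V" and g: "g holomorphic_on UNIV"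
    and bdd: "\<And>z. z \<in> strip \<Longrightarrow> cmod (g z) \<le> B"
    and van: "((\<lambda>t::real. g (\<i> * t)) \<longlongrightarrow> 0) at_infinity"
      "((\<lambda>t::real. g (1 + \<i> * t)) \<longlongrightarrow> 0) at_infinity"
  shows "(\<lambda>z. sc (g z) v) \<in> calderon sc X Y"
proof -
  have dg: "(g has_field_derivative deriv g z) (at z)" for z
    using g by (simp add: holomorphic_derivI)
  then have cg: "isCont g z" for z by (rule DERIV_isCont)
  have shrink: "((\<lambda>x. nrm Z (sc (c x) v)) \<longlongrightarrow> 0) F"
    if "seminormed_space sc V Z" "(c \<longlongrightarrow> 0) F"
    for Z and c :: "real \<Rightarrow> complex" and F
  proof -
    interpret Z: seminormed_space sc V Z by fact
    have "((\<lambda>x. cmod (c x) * nrm Z v) \<longlongrightarrow> 0) F"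
      using tendsto_mult_right[OF tendsto_norm_zero[OF that(2)], of "nrm Z v"] by simp
    then show ?thesis
      using Z.scale_le[OF v] Z.nonneg[OF Z.scale_mem[OF v]]
      by (elim Lim_null_comparison[rotated]) simp
  qed
  have line: "((\<lambda>s::real. g (c + \<i> * s) - g (c + \<i> * t)) \<longlongrightarrow> 0) (at t)" for c t
    by (rule LIM_zero) (rule isCont_tendsto_compose[OF cg], intro tendsto_intros)
  show ?thesis unfolding calderon_def mem_Collect_eq
  proof (intro conjI ballI allI)
    fix z :: complex assume "z \<in> strip"
    show "sc (g z) v \<in> carr (sum_space X Y)" by (simp add: carr_sum X.scale_mem v)
    have "((\<lambda>w. cmod (g w - g z)) \<longlongrightarrow> 0) (at z within strip)"
      using cg[of z] by (intro tendsto_norm_zero LIM_zero)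
        (auto simp: isCont_def intro: tendsto_within_subset)
    then show "nlim (sum_space X Y) (\<lambda>z. sc (g z) v) (sc (g z) v) (at z within strip)"
      by (simp add: nlim_def X.scale_diff v nrm_sum_scale_tendsto)
  next
    have "nrm (sum_space X Y) (sc (g z) v) \<le> B * nrm X v" if "z \<in> strip" for z
      using nrm_sum_le[OF X.scale_mem[OF v]] X.scale_le[OF v, of "g z"]
        mult_right_mono[OF bdd[OF that] X.nonneg[OF v]] by (meson order_trans)
    then show "\<exists>B. \<forall>z\<in>strip. nrm (sum_space X Y) (sc (g z) v) \<le> B" by blast
  next
    fix z :: complex
    have "((\<lambda>w. cmod ((g w - g z) / (w - z) - deriv g z)) \<longlongrightarrow> 0) (at z)"
      using dg[of z] by (intro tendsto_norm_zero LIM_zero) (simp add: has_field_derivative_iff)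
    then show "\<exists>D\<in>carr (sum_space X Y).
        nlim (sum_space X Y) (\<lambda>w. sc (1 / (w - z)) (sc (g w) v - sc (g z) v)) D (at z)"
      by (intro bexI[of _ "sc (deriv g z) v"])
        (simp_all add: nlim_def X.scale_diff X.scale_scale v nrm_sum_scale_tendsto carr_sum X.scale_mem)
  next
    fix t :: real
    show "sc (g (\<i> * t)) v \<in> carr X" "sc (g (1 + \<i> * t)) v \<in> carr Y"
      by (simp_all add: X.carr Y.carr X.scale_mem v)
    show "nlim X (\<lambda>s::real. sc (g (\<i> * s)) v) (sc (g (\<i> * t)) v) (at t)"
      using shrink[OF X.seminormed_space_axioms line[of 0 t]] by (simp add: nlim_def X.scale_diff v)
    show "nlim Y (\<lambda>s::real. sc (g (1 + \<i> * s)) v) (sc (g (1 + \<i> * t)) v) (at t)"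
      using shrink[OF Y.seminormed_space_axioms line[of 1 t]] by (simp add: nlim_def X.scale_diff v)
  qed (rule shrink[OF X.seminormed_space_axioms van(1)] shrink[OF Y.seminormed_space_axioms van(2)])+
qed

text \<open>
  The function \<open>z \<mapsto> exp ((z - \<theta>) * (a - b)) v\<close> takes the value \<open>v\<close> at \<open>\<theta>\<close>, and on both boundary
  lines it balances the bounds \<open>exp a\<close> and \<open>exp b\<close> for the two norms of \<open>v\<close> to the common
  value \<open>exp ((1 - \<theta>) * a + \<theta> * b)\<close>. The Gaussian factor \<open>exp (z\<^sup>2 - \<theta>\<^sup>2)\<close> forces the decay at
  infinity; it costs the factor \<open>exp 1\<close>, which is harmless in a coarse setting.
\<close>

lemma interp_witness:
  fixes \<theta> a b c :: real
  assumes v: "v \<in> V" and \<theta>: "\<theta> \<in> {0..1}" and c: "0 \<le> c"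
    and X: "nrm X v \<le> c * exp a" and Y: "nrm Y v \<le> c * exp b"
  obtains f where "f \<in> calderon sc X Y" "f (complex_of_real \<theta>) = v"
    "calderon_norm X Y f \<le> exp 1 * c * exp ((1 - \<theta>) * a + \<theta> * b)"
proof -
  define g where "g z = exp (z\<^sup>2 - of_real (\<theta>\<^sup>2) + (z - of_real \<theta>) * of_real (a - b))" for z :: complex
  have cmod_g: "cmod (g z) = exp ((Re z)\<^sup>2 - (Im z)\<^sup>2 - \<theta>\<^sup>2 + (Re z - \<theta>) * (a - b))" for z
    by (simp add: g_def Re_power2)
  let ?f = "\<lambda>z. sc (g z) v"
  have "?f \<in> calderon sc X Y"
  proof (rule scalar_multiple_in_calderon[OF v])
    show "g holomorphic_on UNIV" unfolding g_def by (intro holomorphic_intros)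
    fix z assume "z \<in> strip"
    then have z: "0 \<le> Re z" "Re z \<le> 1" by (auto simp: strip_def)
    then have "(Re z)\<^sup>2 \<le> 1" by (simp add: power_le_one)
    moreover have "(Re z - \<theta>) * (a - b) \<le> 1 * \<bar>a - b\<bar>"
    proof (rule order_trans[OF abs_ge_self], unfold abs_mult, rule mult_right_mono)
      show "\<bar>Re z - \<theta>\<bar> \<le> 1" using z \<theta> by auto
    qed simp
    moreover have "(Re z)\<^sup>2 - (Im z)\<^sup>2 - \<theta>\<^sup>2 \<le> (Re z)\<^sup>2" by simp
    ultimately have "(Re z)\<^sup>2 - (Im z)\<^sup>2 - \<theta>\<^sup>2 + (Re z - \<theta>) * (a - b) \<le> 1 + 1 * \<bar>a - b\<bar>"
      by (meson add_mono order_trans)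
    then show "cmod (g z) \<le> exp (1 + \<bar>a - b\<bar>)" by (simp add: cmod_g)
  next
    have "((\<lambda>t::real. exp (k - t\<^sup>2)) \<longlongrightarrow> 0) at_infinity" for k
      unfolding at_infinity_eq_at_top_bot by (rule filterlim_sup; real_asymp)
    from this[of "- \<theta>\<^sup>2 + (0 - \<theta>) * (a - b)"] this[of "1 - \<theta>\<^sup>2 + (1 - \<theta>) * (a - b)"]
    show "((\<lambda>t::real. g (\<i> * t)) \<longlongrightarrow> 0) at_infinity"
      "((\<lambda>t::real. g (1 + \<i> * t)) \<longlongrightarrow> 0) at_infinity"
      by (rule_tac [!] tendsto_norm_zero_cancel) (simp_all add: cmod_g algebra_simps)
  qed
  moreover have "?f (complex_of_real \<theta>) = v" by (simp add: g_def X.scale_one v)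
  moreover have "calderon_norm X Y ?f \<le> exp 1 * c * exp ((1 - \<theta>) * a + \<theta> * b)"
  proof -
    have "nrm X (sc (g (\<i> * t)) v) \<le> exp 1 * c * exp ((1 - \<theta>) * a + \<theta> * b)" for t :: real
    proof -
      have "nrm X (sc (g (\<i> * t)) v) \<le> cmod (g (\<i> * t)) * nrm X v" by (rule X.scale_le[OF v])
      also have "\<dots> \<le> exp (1 - \<theta> * (a - b)) * (c * exp a)"
        unfolding cmod_g using X.nonneg[OF v]
        by (intro mult_mono X) (auto simp: algebra_simps add_nonneg_nonneg intro: order_trans[of _ 0])
      also have "\<dots> = exp 1 * c * exp ((1 - \<theta>) * a + \<theta> * b)"
        by (simp add: exp_add exp_diff field_simps)
      finally show ?thesis .
    qed
    moreover have "nrm Y (sc (g (1 + \<i> * t)) v) \<le> exp 1 * c * exp ((1 - \<theta>) * a + \<theta> * b)" for t :: real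
    proof -
      have "nrm Y (sc (g (1 + \<i> * t)) v) \<le> cmod (g (1 + \<i> * t)) * nrm Y v" by (rule Y.scale_le[OF v])
      also have "\<dots> \<le> exp (1 + (1 - \<theta>) * (a - b)) * (c * exp b)"
        unfolding cmod_g using Y.nonneg[OF v]
        by (intro mult_mono Y) auto
      also have "\<dots> = exp 1 * c * exp ((1 - \<theta>) * a + \<theta> * b)"
        by (simp add: exp_add exp_diff algebra_simps)
      finally show ?thesis .
    qed
    ultimately show ?thesis unfolding calderon_norm_def by (intro max.boundedI cSUP_least) auto
  qed
  ultimately show ?thesis using that by blast
qed

lemma carr_interp:
  assumes "\<theta> \<in> {0..1}" shows "carr (interp sc X Y \<theta>) = V"
proof
  show "carr (interp sc X Y \<theta>) \<subseteq> V"
    using assms by (auto simp: interp_def calderon_def carr_sum strip_def)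
  show "V \<subseteq> carr (interp sc X Y \<theta>)"
  proof
    fix v assume v: "v \<in> V"
    from v obtain f where "f \<in> calderon sc X Y" "f (complex_of_real \<theta>) = v"
      by (rule interp_witness[of v \<theta> "max (nrm X v) (nrm Y v)" 0 0])
        (use assms X.nonneg[OF v] in auto)
    then show "v \<in> carr (interp sc X Y \<theta>)" by (auto simp: interp_def)
  qed
qed

lemma bdd_above_boundary:
  assumes "f \<in> calderon sc X Y"
  shows "bdd_above (range (\<lambda>t::real. nrm X (f (\<i> * t))))"
    and "bdd_above (range (\<lambda>t::real. nrm Y (f (1 + \<i> * t))))"
proof -
  have f: "\<And>t::real. f (\<i> * t) \<in> V \<and> f (1 + \<i> * t) \<in> V"
    "\<And>t::real. nlim X (\<lambda>s::real. f (\<i> * s)) (f (\<i> * t)) (at t)"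
    "\<And>t::real. nlim Y (\<lambda>s::real. f (1 + \<i> * s)) (f (1 + \<i> * t)) (at t)"
    "((\<lambda>t::real. nrm X (f (\<i> * t))) \<longlongrightarrow> 0) at_infinity"
    "((\<lambda>t::real. nrm Y (f (1 + \<i> * t))) \<longlongrightarrow> 0) at_infinity"
    using assms by (simp_all add: calderon_def X.carr Y.carr)
  show "bdd_above (range (\<lambda>t::real. nrm X (f (\<i> * t))))"
    using f by (intro X.nrm_bounded_of_vanishing[of "\<lambda>t. f (\<i> * of_real t)"]) simp_all
  show "bdd_above (range (\<lambda>t::real. nrm Y (f (1 + \<i> * t))))"
    using f by (intro Y.nrm_bounded_of_vanishing[of "\<lambda>t. f (1 + \<i> * of_real t)"]) simp_all
qed

lemma calderon_norm_ge:
  fixes t :: real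
  assumes "f \<in> calderon sc X Y"
  shows "nrm X (f (\<i> * t)) \<le> calderon_norm X Y f"
    and "nrm Y (f (1 + \<i> * t)) \<le> calderon_norm X Y f"
  using cSUP_upper[OF UNIV_I bdd_above_boundary(1)[OF assms], of t]
    cSUP_upper[OF UNIV_I bdd_above_boundary(2)[OF assms], of t]
  unfolding calderon_norm_def by linarith+

lemma nrm_interp_le:
  assumes v: "v \<in> V" and \<theta>: "\<theta> \<in> {0..1}" and c: "0 \<le> c"
    and X: "nrm X v \<le> c * exp a" and Y: "nrm Y v \<le> c * exp b"
  shows "nrm (interp sc X Y \<theta>) v \<le> exp 1 * c * exp ((1 - \<theta>) * a + \<theta> * b)"
proof -
  obtain f where f: "f \<in> calderon sc X Y" "f (complex_of_real \<theta>) = v"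
    "calderon_norm X Y f \<le> exp 1 * c * exp ((1 - \<theta>) * a + \<theta> * b)"
    using interp_witness[OF assms] .
  have "0 \<le> calderon_norm X Y f" if "f \<in> calderon sc X Y" for f
  proof -
    have "f 0 \<in> V" using that by (simp add: calderon_def carr_sum strip_def)
    then show ?thesis using calderon_norm_ge(1)[OF that, of 0] X.nonneg[of "f 0"] by simp
  qed
  then have "bdd_below {calderon_norm X Y f |f. f \<in> calderon sc X Y \<and> f (complex_of_real \<theta>) = v}"
    by (auto intro: bdd_belowI[of _ 0])
  then show ?thesis unfolding interp_def nspace.simps
    using f by (intro cInf_lower2[of "calderon_norm X Y f"]) blast+
qed

text \<open>
  A linear functional bounded by \<open>exp a\<close> for the first norm and by \<open>exp b\<close> for the second one is
  bounded by the geometric mean for the interpolated norm: for \<open>f\<close> in the Calderon space with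
  \<open>f \<theta> = v\<close>, apply the three lines theorem to \<open>exp (- ((1 - z) * a + z * b)) * \<phi> (f z)\<close>. This is
  the only source of lower bounds for interpolation norms.
\<close>

lemma functional_le_nrm_interp:
  assumes \<theta>: "\<theta> \<in> {0..1}" and v: "v \<in> V"
    and add: "\<And>u w. u \<in> V \<Longrightarrow> w \<in> V \<Longrightarrow> \<phi> (u + w) = \<phi> u + \<phi> w"
    and scale: "\<And>c u. u \<in> V \<Longrightarrow> \<phi> (sc c u) = c * \<phi> u"
    and X: "\<And>u. u \<in> V \<Longrightarrow> cmod (\<phi> u) \<le> exp a * nrm X u"
    and Y: "\<And>u. u \<in> V \<Longrightarrow> cmod (\<phi> u) \<le> exp b * nrm Y u"
  shows "cmod (\<phi> v) \<le> exp ((1 - \<theta>) * a + \<theta> * b) * nrm (interp sc X Y \<theta>) v"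
proof -
  have diff: "\<phi> (u - w) = \<phi> u - \<phi> w" if "u \<in> V" "w \<in> V" for u w
    using add[OF X.diff_mem[OF that] that(2)] X.diff_add[OF that] by simp
  define K where "K = exp (max a b)"
  have le_sum: "cmod (\<phi> u) \<le> K * nrm (sum_space X Y) u" if "u \<in> V" for u
  proof -
    have "cmod (\<phi> u) / K \<le> nrm (sum_space X Y) u"
    proof (rule nrm_sum_greatest[OF that])
      fix p q assume pq: "p \<in> V" "q \<in> V" "u = p + q"
      have "cmod (\<phi> u) \<le> cmod (\<phi> p) + cmod (\<phi> q)" by (simp add: pq add norm_triangle_ineq)
      also have "\<dots> \<le> exp a * nrm X p + exp b * nrm Y q" by (intro add_mono X Y pq)
      also have "\<dots> \<le> K * nrm X p + K * nrm Y q"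
        unfolding K_def by (intro add_mono mult_right_mono X.nonneg Y.nonneg pq) auto
      finally show "cmod (\<phi> u) / K \<le> nrm X p + nrm Y q"
        by (simp add: K_def field_simps)
    qed
    then show ?thesis by (simp add: K_def field_simps)
  qed
  have bound: "cmod (\<phi> (f (complex_of_real \<theta>))) \<le> exp ((1 - \<theta>) * a + \<theta> * b) * calderon_norm X Y f"
    if f: "f \<in> calderon sc X Y" for f
  proof -
    have mem: "f z \<in> V" if "z \<in> strip" for z
      using f that by (auto simp: calderon_def carr_sum)
    \<comment> \<open>Convergence in the sum norm makes the scalar function continuous on the strip and
    differentiable inside it.\<close>
    have to_scalar: "((\<lambda>x. \<phi> (p x)) \<longlongrightarrow> \<phi> l) F"
      if "nlim (sum_space X Y) p l F" "\<forall>\<^sub>F x in F. p x \<in> V" "l \<in> V" for p :: "complex \<Rightarrow> 'v" and l F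
    proof (rule LIM_zero_cancel, rule Lim_null_comparison)
      show "((\<lambda>x. K * nrm (sum_space X Y) (p x - l)) \<longlongrightarrow> 0) F"
        using tendsto_mult_left[OF that(1)[unfolded nlim_def], of K] by simp
      show "\<forall>\<^sub>F x in F. cmod (\<phi> (p x) - \<phi> l) \<le> K * nrm (sum_space X Y) (p x - l)"
        using that(2) by eventually_elim (use that(3) le_sum[OF X.diff_mem] in \<open>simp add: diff\<close>)
    qed
    have cont: "continuous_on strip (\<lambda>z. \<phi> (f z))"
      unfolding continuous_on_def
    proof
      fix z assume z: "z \<in> strip"
      have "\<forall>\<^sub>F w in at z within strip. f w \<in> V"
        by (auto simp: eventually_at_filter mem)
      then show "((\<lambda>z. \<phi> (f z)) \<longlongrightarrow> \<phi> (f z)) (at z within strip)"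
        using f z by (intro to_scalar) (auto simp: calderon_def mem)
    qed
    have holo: "(\<lambda>z. \<phi> (f z)) holomorphic_on interior strip"
    proof (subst holomorphic_on_open, simp, intro ballI)
      fix z assume z: "z \<in> interior strip"
      then have zs: "z \<in> strip" using interior_subset by blast
      obtain D where D: "D \<in> V"
        "nlim (sum_space X Y) (\<lambda>w. sc (1 / (w - z)) (f w - f z)) D (at z)"
        using f z by (auto simp: calderon_def carr_sum)
      have ev: "\<forall>\<^sub>F w in at z. w \<in> strip"
        using eventually_at_in_open'[OF open_interior z]
        by eventually_elim (rule subsetD[OF interior_subset])
      have "((\<lambda>w. \<phi> (sc (1 / (w - z)) (f w - f z))) \<longlongrightarrow> \<phi> D) (at z)"
        using ev by (intro to_scalar D) (auto elim!: eventually_mono intro!: X.scale_mem X.diff_mem mem zs)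
      moreover have "\<forall>\<^sub>F w in at z. \<phi> (sc (1 / (w - z)) (f w - f z)) = (\<phi> (f w) - \<phi> (f z)) / (w - z)"
        using ev by eventually_elim (simp add: scale diff mem zs X.diff_mem)
      ultimately have "((\<lambda>w. (\<phi> (f w) - \<phi> (f z)) / (w - z)) \<longlongrightarrow> \<phi> D) (at z)"
        using tendsto_cong by fastforce
      then show "\<exists>f'. ((\<lambda>z. \<phi> (f z)) has_field_derivative f') (at z)"
        by (auto simp: has_field_derivative_iff)
    qed
    obtain B where B: "\<And>z. z \<in> strip \<Longrightarrow> nrm (sum_space X Y) (f z) \<le> B"
      using f by (auto simp: calderon_def)
    define e where "e z = exp (- ((1 - z) * of_real a + z * of_real b))" for z :: complex
    have cmod_e: "cmod (e z) = exp (- ((1 - Re z) * a + Re z * b))" for z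
      by (simp add: e_def)
    have "cmod (e (of_real \<theta>) * \<phi> (f (of_real \<theta>))) \<le> calderon_norm X Y f"
    proof (rule three_lines[where h = "\<lambda>z. e z * \<phi> (f z)"])
      show "continuous_on strip (\<lambda>z. e z * \<phi> (f z))"
        unfolding e_def by (intro continuous_intros cont)
      show "(\<lambda>z. e z * \<phi> (f z)) holomorphic_on interior strip"
        unfolding e_def by (intro holomorphic_intros holo)
      show "complex_of_real \<theta> \<in> strip" using \<theta> by (simp add: strip_def)
    next
      fix z assume z: "z \<in> strip"
      have "(1 - Re z) * (- a) + Re z * (- b) \<le> max (- a) (- b)"
        using z by (intro convex_bound_le) (auto simp: strip_def)
      then have "cmod (e z) \<le> exp (max (- a) (- b))" by (simp add: cmod_e)
      moreover have "cmod (\<phi> (f z)) \<le> K * B"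
        using order_trans[OF le_sum[OF mem[OF z]] mult_left_mono[OF B[OF z]]] by (simp add: K_def)
      ultimately show "cmod (e z * \<phi> (f z)) \<le> exp (max (- a) (- b)) * (K * B)"
        unfolding norm_mult by (intro mult_mono) auto
    next
      fix z :: complex assume "Re z = 0 \<or> Re z = 1"
      then consider t :: real where "z = \<i> * t" | t :: real where "z = 1 + \<i> * t"
        by (metis complex_eq complex_of_real_i add_0 of_real_0 of_real_1)
      then show "cmod (e z * \<phi> (f z)) \<le> calderon_norm X Y f"
      proof cases
        case 1
        have "cmod (e z * \<phi> (f z)) \<le> exp (- a) * (exp a * nrm X (f z))"
          using X[OF mem[of z]] by (simp add: norm_mult cmod_e 1 strip_def)
        also have "\<dots> = nrm X (f z)" by (simp add: exp_minus)
        also have "\<dots> \<le> calderon_norm X Y f" unfolding 1 by (rule calderon_norm_ge(1)[OF f])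
        finally show ?thesis .
      next
        case 2
        have "cmod (e z * \<phi> (f z)) \<le> exp (- b) * (exp b * nrm Y (f z))"
          using Y[OF mem[of z]] by (simp add: norm_mult cmod_e 2 strip_def)
        also have "\<dots> = nrm Y (f z)" by (simp add: exp_minus)
        also have "\<dots> \<le> calderon_norm X Y f" unfolding 2 by (rule calderon_norm_ge(2)[OF f])
        finally show ?thesis .
      qed
    qed
    then show ?thesis
      by (simp add: norm_mult cmod_e[of "of_real \<theta>", unfolded exp_minus] pos_divide_le_eq
          flip: divide_inverse_commute) (simp add: mult.commute)
  qed
  have "{calderon_norm X Y f |f. f \<in> calderon sc X Y \<and> f (complex_of_real \<theta>) = v} \<noteq> {}"
    using v carr_interp[OF \<theta>] by (auto simp: interp_def)
  moreover have "cmod (\<phi> v) / exp ((1 - \<theta>) * a + \<theta> * b) \<le> calderon_norm X Y f"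
    if "f \<in> calderon sc X Y" "f (complex_of_real \<theta>) = v" for f
    using bound[OF that(1)] that(2) by (simp add: pos_divide_le_eq mult.commute)
  ultimately have "cmod (\<phi> v) / exp ((1 - \<theta>) * a + \<theta> * b) \<le> nrm (interp sc X Y \<theta>) v"
    unfolding interp_def nspace.simps by (intro cInf_greatest) blast+
  then show ?thesis by (simp add: pos_divide_le_eq mult.commute)
qed

end

section \<open>Rows and columns over the sequence space\<close>

text \<open>
  This pairing is bilinear, without conjugation, to match the complex-linear identification of \<open>\<ell>\<^sub>2\<close>
  with the row operators.
\<close>

definition pairing :: "ell2 \<Rightarrow> ell2 \<Rightarrow> complex" where
  "pairing x y = (\<Sum>k. coord x k * coord y k)"

lemma pairing_add_left: "pairing (x + y) z = pairing x z + pairing y z"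
  by (simp add: pairing_def plus_ell2.rep_eq distrib_right suminf_add summable_coord_mult)

lemma pairing_scale_left: "pairing (scale_ell2 c x) y = c * pairing x y"
  by (simp add: pairing_def scale_ell2.rep_eq mult.assoc suminf_mult summable_coord_mult)

lemma pairing_scale_right: "pairing x (scale_ell2 c y) = c * pairing x y"
  by (simp add: pairing_def scale_ell2.rep_eq mult.left_commute suminf_mult summable_coord_mult)

lemma pairing_basis_left: "pairing (basis_ell2 j) y = coord y j"
proof -
  have "pairing (basis_ell2 j) y = (\<Sum>k\<in>{j}. coord (basis_ell2 j) k * coord y k)"
    unfolding pairing_def by (rule suminf_finite) (auto simp: basis_ell2.rep_eq)
  then show ?thesis by (simp add: basis_ell2.rep_eq)
qed

lemma norming_vector: "\<exists>u. norm u \<le> 1 \<and> pairing x u = complex_of_real (norm x)"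
proof (cases "x = 0")
  case True
  then show ?thesis by (intro exI[of _ 0]) (simp add: pairing_def zero_ell2.rep_eq)
next
  case False
  define y where "y = Abs_ell2 (\<lambda>k. cnj (coord x k))"
  have y: "coord y = (\<lambda>k. cnj (coord x k))"
    unfolding y_def by (rule Abs_ell2_inverse) (simp add: square_summable_coord)
  have ny: "norm y = norm x" by (simp add: norm_ell2_eq y)
  have nx: "(norm x)\<^sup>2 = (\<Sum>k. (cmod (coord x k))\<^sup>2)"
    by (simp add: norm_ell2_eq suminf_nonneg square_summable_coord)
  have "pairing x y = (\<Sum>k. complex_of_real ((cmod (coord x k))\<^sup>2))"
    unfolding pairing_def by (simp only: y complex_norm_square)
  also have "\<dots> = complex_of_real ((norm x)\<^sup>2)"
    by (simp only: nx suminf_of_real[OF square_summable_coord])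
  finally show ?thesis using False
    by (intro exI[of _ "scale_ell2 (1 / norm x) y"])
      (simp add: norm_scale_ell2 ny norm_divide pairing_scale_right power2_eq_square)
qed

lemma row_op_pairing: "row_op x \<xi> = scale_ell2 (pairing x \<xi>) (basis_ell2 0)"
  by (simp add: row_op_apply pairing_def)

lemma norm_row_op_apply: "norm (row_op x \<xi>) = cmod (pairing x \<xi>)"
  by (simp add: row_op_pairing norm_scale_ell2 norm_basis_ell2)

lemma row_op_add: "row_op (x + y) = row_op x + row_op y"
  by (rule blinfun_eqI)
    (simp add: row_op_pairing pairing_add_left blinfun.add_left ell2.scale_left_distrib)

lemma row_op_scale: "row_op (scale_ell2 c x) = scale_op c (row_op x)"
  by (rule blinfun_eqI) (simp add: row_op_pairing pairing_scale_left scale_op_apply)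

lemma col_op_add: "col_op (x + y) = col_op x + col_op y"
  by (rule blinfun_eqI) (simp add: col_op_apply blinfun.add_left ell2.scale_right_distrib)

lemma col_op_scale: "col_op (scale_ell2 c x) = scale_op c (col_op x)"
  by (rule blinfun_eqI) (simp add: col_op_apply scale_op_apply mult.commute)

lemma basis_expansion: "(\<lambda>N. \<Sum>k<N. scale_ell2 (coord x k) (basis_ell2 k)) \<longlonglongrightarrow> x"
proof (rule LIMSEQ_I)
  fix r :: real assume r: "0 < r"
  define S where "S N = (\<Sum>k<N. scale_ell2 (coord x k) (basis_ell2 k))" for N
  have S: "coord (S N) i = (if i < N then coord x i else 0)" for N i
    unfolding S_def by (induction N)
      (auto simp: zero_ell2.rep_eq plus_ell2.rep_eq scale_ell2.rep_eq basis_ell2.rep_eq less_Suc_eq)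
  obtain N where N: "\<And>n. n \<ge> N \<Longrightarrow> norm (\<Sum>i. (cmod (coord x (i + n)))\<^sup>2) < r\<^sup>2"
    using suminf_exist_split[OF _ square_summable_coord, of "r\<^sup>2" x] r by auto
  have "norm (S n - x) < r" if "n \<ge> N" for n
  proof -
    have 0: "(\<Sum>i<n. (cmod (coord (S n - x) i))\<^sup>2) = 0"
      by (simp add: minus_ell2.rep_eq S)
    have "(\<Sum>k. (cmod (coord (S n - x) k))\<^sup>2) = (\<Sum>k. (cmod (coord (S n - x) (k + n)))\<^sup>2)"
      using suminf_split_initial_segment[OF square_summable_coord, of "S n - x" n] 0 by simp
    also have "\<dots> = (\<Sum>i. (cmod (coord x (i + n)))\<^sup>2)"
      by (simp add: minus_ell2.rep_eq S)
    also have "\<dots> < r\<^sup>2" using N[OF that] by simp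
    finally show ?thesis using r by (simp add: norm_ell2_eq real_less_lsqrt)
  qed
  then show "\<exists>N. \<forall>n\<ge>N. norm ((\<Sum>k<n. scale_ell2 (coord x k) (basis_ell2 k)) - x) < r"
    unfolding S_def by blast
qed

text \<open>
  With the density of the finitely supported sequences, this shows that both \<open>R\<close> and \<open>C\<close> are
  identified with all of \<open>\<ell>\<^sub>2\<close>.
\<close>

lemma in_closed_span_of_basis_images:
  fixes h :: "ell2 \<Rightarrow> (ell2 \<Rightarrow>\<^sub>L ell2)"
  assumes add: "\<And>x y. h (x + y) = h x + h y"
    and scale: "\<And>c x. h (scale_ell2 c x) = scale_op c (h x)"
    and norm: "\<And>x. norm (h x) = norm x"
    and U: "\<And>k. h (basis_ell2 k) \<in> U"
  shows "h x \<in> closure (op.span U)"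
proof -
  have h0: "h 0 = 0" using norm[of 0] by simp
  have diff: "h (x - y) = h x - h y" for x y using add[of "x - y" y] by simp
  have "h (\<Sum>k<N. scale_ell2 (coord x k) (basis_ell2 k)) \<in> op.span U" for N
    by (induction N) (simp_all add: h0 add scale op.span_zero op.span_add op.span_scale op.span_base U)
  moreover have "(\<lambda>N. h (\<Sum>k<N. scale_ell2 (coord x k) (basis_ell2 k))) \<longlonglongrightarrow> h x"
    using basis_expansion[of x] unfolding LIMSEQ_iff by (simp add: diff[symmetric] norm)
  ultimately show ?thesis by (auto simp: closure_sequential intro!: exI)
qed

lemma elems_row_space: "elems row_space = UNIV"
proof -
  have "row_op x \<in> closure (op.span {unit_op 0 j |j. True})" for x
    by (rule in_closed_span_of_basis_images)
      (simp_all only: row_op_add row_op_scale norm_row_op row_op_basis, blast)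
  then show ?thesis by (simp add: row_space_def row_ops_def)
qed

lemma elems_col_space: "elems col_space = UNIV"
proof -
  have "col_op x \<in> closure (op.span {unit_op j 0 |j. True})" for x
    by (rule in_closed_span_of_basis_images)
      (simp_all only: col_op_add col_op_scale norm_col_op col_op_basis, blast)
  then show ?thesis by (simp add: col_space_def col_ops_def)
qed

section \<open>The norm of a matrix of operators\<close>

lemma op_mat_norm_upper:
  fixes A :: "(ell2 \<Rightarrow>\<^sub>L ell2) mat" and \<xi> :: "nat \<Rightarrow> ell2"
  assumes \<xi>: "L2_set (\<lambda>j. norm (\<xi> j)) {..<dim_col A} \<le> 1"
  shows "L2_set (\<lambda>i. norm (\<Sum>j<dim_col A. (A $$ (i, j)) (\<xi> j))) {..<dim_row A} \<le> op_mat_norm A"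
  unfolding op_mat_norm_def
proof (rule cSup_upper)
  show "bdd_above {L2_set (\<lambda>i. norm (\<Sum>j<dim_col A. blinfun_apply (A $$ (i, j)) (\<xi> j))) {..<dim_row A}
     |\<xi>. L2_set (\<lambda>j. norm (\<xi> j)) {..<dim_col A} \<le> 1}"
  proof (rule bdd_aboveI, clarify)
    fix \<xi> :: "nat \<Rightarrow> ell2" assume \<xi>: "L2_set (\<lambda>j. norm (\<xi> j)) {..<dim_col A} \<le> 1"
    have "norm (\<xi> j) \<le> 1" if "j < dim_col A" for j
      using member_le_L2_set[of "{..<dim_col A}" j "\<lambda>j. norm (\<xi> j)"] that \<xi> by simp
    then have "norm (A $$ (i, j)) * norm (\<xi> j) \<le> norm (A $$ (i, j)) * 1" if "j < dim_col A" for i j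
      using that by (intro mult_left_mono) auto
    then have "norm ((A $$ (i, j)) (\<xi> j)) \<le> norm (A $$ (i, j))" if "j < dim_col A" for i j
      using that by (intro order_trans[OF norm_blinfun]) simp
    then have "norm (\<Sum>j<dim_col A. (A $$ (i, j)) (\<xi> j)) \<le> (\<Sum>j<dim_col A. norm (A $$ (i, j)))" for i
      by (intro sum_norm_le) simp
    then show "L2_set (\<lambda>i. norm (\<Sum>j<dim_col A. (A $$ (i, j)) (\<xi> j))) {..<dim_row A}
        \<le> L2_set (\<lambda>i. \<Sum>j<dim_col A. norm (A $$ (i, j))) {..<dim_row A}"
      by (intro L2_set_mono) auto
  qed
qed (use \<xi> in blast)

lemma op_mat_norm_least:
  fixes A :: "(ell2 \<Rightarrow>\<^sub>L ell2) mat"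
  assumes "\<And>\<xi>. L2_set (\<lambda>j. norm (\<xi> j)) {..<dim_col A} \<le> 1 \<Longrightarrow>
    L2_set (\<lambda>i. norm (\<Sum>j<dim_col A. (A $$ (i, j)) (\<xi> j))) {..<dim_row A} \<le> b"
  shows "op_mat_norm A \<le> b"
proof -
  have "L2_set (\<lambda>j. norm (0 :: ell2)) {..<dim_col A} \<le> 1" by (simp add: L2_set_def)
  then have "\<exists>\<xi> :: nat \<Rightarrow> ell2. L2_set (\<lambda>j. norm (\<xi> j)) {..<dim_col A} \<le> 1"
    by (intro exI[of _ "\<lambda>_. 0"])
  then have "{L2_set (\<lambda>i. norm (\<Sum>j<dim_col A. (A $$ (i, j)) (\<xi> j))) {..<dim_row A}
     |\<xi>. L2_set (\<lambda>j. norm (\<xi> j)) {..<dim_col A} \<le> 1} \<noteq> {}" by simp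
  then show ?thesis unfolding op_mat_norm_def
  proof (rule cSup_least, clarify)
    fix \<xi> :: "nat \<Rightarrow> ell2"
    assume "L2_set (\<lambda>j. norm (\<xi> j)) {..<dim_col A} \<le> 1"
    then show "L2_set (\<lambda>i. norm (\<Sum>j<dim_col A. (A $$ (i, j)) (\<xi> j))) {..<dim_row A} \<le> b"
      by (rule assms)
  qed
qed

lemma op_mat_norm_row_upper:
  fixes A :: "(ell2 \<Rightarrow>\<^sub>L ell2) mat" and \<xi> :: "nat \<Rightarrow> ell2"
  assumes "L2_set (\<lambda>j. norm (\<xi> j)) {..<dim_col A} \<le> 1" "i < dim_row A"
  shows "norm (\<Sum>j<dim_col A. (A $$ (i, j)) (\<xi> j)) \<le> op_mat_norm A"
  using member_le_L2_set[of "{..<dim_row A}" i "\<lambda>i. norm (\<Sum>j<dim_col A. (A $$ (i, j)) (\<xi> j))"]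
    op_mat_norm_upper[OF assms(1)] assms(2) by simp

lemma op_mat_norm_nonneg: "0 \<le> op_mat_norm A"
  using op_mat_norm_upper[of "\<lambda>_. 0" A] by (simp add: L2_set_def)

lemma op_mat_norm_add:
  fixes A B :: "(ell2 \<Rightarrow>\<^sub>L ell2) mat"
  assumes A: "A \<in> carrier_mat n m" and B: "B \<in> carrier_mat n m"
  shows "op_mat_norm (A + B) \<le> op_mat_norm A + op_mat_norm B"
proof (rule op_mat_norm_least)
  fix \<xi> :: "nat \<Rightarrow> ell2" assume "L2_set (\<lambda>j. norm (\<xi> j)) {..<dim_col (A + B)} \<le> 1"
  then have \<xi>: "L2_set (\<lambda>j. norm (\<xi> j)) {..<m} \<le> 1" using B by simp
  have "L2_set (\<lambda>i. norm (\<Sum>j<m. ((A + B) $$ (i, j)) (\<xi> j))) {..<n}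
      \<le> L2_set (\<lambda>i. norm (\<Sum>j<m. (A $$ (i, j)) (\<xi> j)) + norm (\<Sum>j<m. (B $$ (i, j)) (\<xi> j))) {..<n}"
    using A B by (intro L2_set_mono) (auto simp: blinfun.add_left sum.distrib norm_triangle_ineq)
  also have "\<dots> \<le> L2_set (\<lambda>i. norm (\<Sum>j<m. (A $$ (i, j)) (\<xi> j))) {..<n}
      + L2_set (\<lambda>i. norm (\<Sum>j<m. (B $$ (i, j)) (\<xi> j))) {..<n}"
    by (rule L2_set_triangle_ineq)
  also have "\<dots> \<le> op_mat_norm A + op_mat_norm B"
    using op_mat_norm_upper[of \<xi> A] op_mat_norm_upper[of \<xi> B] \<xi> A B by (intro add_mono) auto
  finally show "L2_set (\<lambda>i. norm (\<Sum>j<dim_col (A + B). ((A + B) $$ (i, j)) (\<xi> j)))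
      {..<dim_row (A + B)} \<le> op_mat_norm A + op_mat_norm B"
    using A B by simp
qed

lemma op_mat_norm_scale: "op_mat_norm (map_mat (scale_op c) A) \<le> cmod c * op_mat_norm A"
proof (rule op_mat_norm_least)
  fix \<xi> :: "nat \<Rightarrow> ell2"
  assume "L2_set (\<lambda>j. norm (\<xi> j)) {..<dim_col (map_mat (scale_op c) A)} \<le> 1"
  then have \<xi>: "L2_set (\<lambda>j. norm (\<xi> j)) {..<dim_col A} \<le> 1" by simp
  have "L2_set (\<lambda>i. norm (\<Sum>j<dim_col A. (map_mat (scale_op c) A $$ (i, j)) (\<xi> j))) {..<dim_row A}
      = L2_set (\<lambda>i. cmod c * norm (\<Sum>j<dim_col A. (A $$ (i, j)) (\<xi> j))) {..<dim_row A}"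
    by (intro L2_set_cong refl) (simp add: scale_op_apply norm_scale_ell2 flip: ell2.scale_sum_right)
  also have "\<dots> = cmod c * L2_set (\<lambda>i. norm (\<Sum>j<dim_col A. (A $$ (i, j)) (\<xi> j))) {..<dim_row A}"
    by (simp add: L2_set_right_distrib)
  also have "\<dots> \<le> cmod c * op_mat_norm A"
    by (intro mult_left_mono op_mat_norm_upper \<xi>) simp
  finally show "L2_set (\<lambda>i. norm (\<Sum>j<dim_col (map_mat (scale_op c) A).
      (map_mat (scale_op c) A $$ (i, j)) (\<xi> j))) {..<dim_row (map_mat (scale_op c) A)}
      \<le> cmod c * op_mat_norm A" by simp
qed

section \<open>The matrix norms of the interpolation spaces\<close>

text \<open>
  Stated for an arbitrary linear map \<open>h\<close> into the operators, so that it covers \<open>row_op\<close> and \<open>col_op\<close>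
  at once.
\<close>

lemma seminormed_space_op_mat:
  fixes h :: "ell2 \<Rightarrow> (ell2 \<Rightarrow>\<^sub>L ell2)"
  assumes add: "\<And>x y. h (x + y) = h x + h y"
    and scale: "\<And>c x. h (scale_ell2 c x) = scale_op c (h x)"
  shows "seminormed_space (\<lambda>c. map_mat (scale_ell2 c)) (carrier_mat n n)
    \<lparr>carr = carrier_mat n n, nrm = \<lambda>A. op_mat_norm (map_mat h A)\<rparr>"
proof
  fix A B :: "ell2 mat" and c :: complex
  assume A: "A \<in> carrier_mat n n"
  have "map_mat h (map_mat (scale_ell2 c) A) = map_mat (scale_op c) (map_mat h A)"
    by (rule eq_matI) (auto simp: scale)
  then show "nrm \<lparr>carr = carrier_mat n n, nrm = \<lambda>A. op_mat_norm (map_mat h A)\<rparr> (map_mat (scale_ell2 c) A)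
      \<le> cmod c * nrm \<lparr>carr = carrier_mat n n, nrm = \<lambda>A. op_mat_norm (map_mat h A)\<rparr> A"
    by (simp add: op_mat_norm_scale)
  assume B: "B \<in> carrier_mat n n"
  have "map_mat h (A + B) = map_mat h A + map_mat h B"
    using A B by (intro eq_matI) (auto simp: add)
  then show "nrm \<lparr>carr = carrier_mat n n, nrm = \<lambda>A. op_mat_norm (map_mat h A)\<rparr> (A + B)
      \<le> nrm \<lparr>carr = carrier_mat n n, nrm = \<lambda>A. op_mat_norm (map_mat h A)\<rparr> A
        + nrm \<lparr>carr = carrier_mat n n, nrm = \<lambda>A. op_mat_norm (map_mat h A)\<rparr> B"
    using op_mat_norm_add[of "map_mat h A" n n "map_mat h B"] A B by simp
qed (auto intro!: eq_matI simp: op_mat_norm_nonneg ell2.scale_left_diff_distrib)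

lemma seminormed_space_op:
  fixes h :: "ell2 \<Rightarrow> (ell2 \<Rightarrow>\<^sub>L ell2)"
  assumes add: "\<And>x y. h (x + y) = h x + h y"
    and scale: "\<And>c x. h (scale_ell2 c x) = scale_op c (h x)"
  shows "seminormed_space scale_ell2 UNIV
    \<lparr>carr = UNIV, nrm = \<lambda>x. op_mat_norm (map_mat h (Matrix.mat 1 1 (\<lambda>_. x)))\<rparr>"
proof -
  interpret seminormed_space "\<lambda>c. map_mat (scale_ell2 c)" "carrier_mat 1 1"
    "\<lparr>carr = carrier_mat 1 1, nrm = \<lambda>A. op_mat_norm (map_mat h A)\<rparr>"
    by (rule seminormed_space_op_mat) (fact add, fact scale)
  let ?\<iota> = "\<lambda>x. Matrix.mat 1 1 (\<lambda>_. x) :: ell2 mat"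
  have sc: "?\<iota> (scale_ell2 c x) = map_mat (scale_ell2 c) (?\<iota> x)" for c x by (intro eq_matI) auto
  have pl: "?\<iota> (x + y) = ?\<iota> x + ?\<iota> y" for x y by (intro eq_matI) auto
  show ?thesis
  proof
    fix x y c
    show "nrm \<lparr>carr = UNIV, nrm = \<lambda>x. op_mat_norm (map_mat h (?\<iota> x))\<rparr> (scale_ell2 c x)
      \<le> cmod c * nrm \<lparr>carr = UNIV, nrm = \<lambda>x. op_mat_norm (map_mat h (?\<iota> x))\<rparr> x"
      using scale_le[of "?\<iota> x" c] by (simp add: sc del: One_nat_def)
    show "nrm \<lparr>carr = UNIV, nrm = \<lambda>x. op_mat_norm (map_mat h (?\<iota> x))\<rparr> (x + y)
      \<le> nrm \<lparr>carr = UNIV, nrm = \<lambda>x. op_mat_norm (map_mat h (?\<iota> x))\<rparr> x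
        + nrm \<lparr>carr = UNIV, nrm = \<lambda>x. op_mat_norm (map_mat h (?\<iota> x))\<rparr> y"
      using triangle[of "?\<iota> x" "?\<iota> y"] by (simp add: pl del: One_nat_def)
  qed (auto simp: op_mat_norm_nonneg ell2.scale_left_diff_distrib)
qed

lemma Mn_row_space: "Mn n row_space =
    \<lparr>carr = carrier_mat n n, nrm = \<lambda>A. op_mat_norm (map_mat row_op A)\<rparr>"
  using elems_row_space by (simp add: Mn_def row_space_def)

lemma Mn_col_space: "Mn n col_space =
    \<lparr>carr = carrier_mat n n, nrm = \<lambda>A. op_mat_norm (map_mat col_op A)\<rparr>"
  using elems_col_space by (simp add: Mn_def col_space_def)

lemma couple_Mn: "couple (\<lambda>c. map_mat (scale_ell2 c)) (carrier_mat n n) (Mn n row_space) (Mn n col_space)"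
  unfolding couple_def Mn_row_space Mn_col_space
  by (intro conjI seminormed_space_op_mat row_op_add row_op_scale col_op_add col_op_scale)

lemma couple_ground: "couple scale_ell2 UNIV (ground row_space) (ground col_space)"
  using seminormed_space_op[OF row_op_add row_op_scale] seminormed_space_op[OF col_op_add col_op_scale]
    elems_row_space elems_col_space
  by (simp add: couple_def ground_def row_space_def col_space_def)

lemma elems_RC: "\<theta> \<in> {0..1} \<Longrightarrow> elems (RC \<theta>) = UNIV"
  by (simp add: RC_def interp_opspace_def couple.carr_interp[OF couple_ground])

lemma carr_Mn_RC: "\<theta> \<in> {0..1} \<Longrightarrow> carr (Mn n (RC \<theta>)) = carrier_mat n n"
  by (simp add: Mn_def elems_RC)

lemma nrm_Mn_RC: "A \<in> carrier_mat n n \<Longrightarrow> nrm (Mn n (RC \<theta>)) A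
    = nrm (interp (\<lambda>c. map_mat (scale_ell2 c)) (Mn n row_space) (Mn n col_space) \<theta>) A"
proof -
  have "nrm (Mn n (RC \<theta>)) = mnrm (RC \<theta>)" by (simp add: Mn_def)
  then show "A \<in> carrier_mat n n \<Longrightarrow> ?thesis" by (simp add: RC_def interp_opspace_def)
qed

lemma nrm_RC_le:
  assumes "\<theta> \<in> {0..1}" "A \<in> carrier_mat n n" "0 \<le> c"
    and "op_mat_norm (map_mat row_op A) \<le> c * exp a"
    and "op_mat_norm (map_mat col_op A) \<le> c * exp b"
  shows "nrm (Mn n (RC \<theta>)) A \<le> exp 1 * c * exp ((1 - \<theta>) * a + \<theta> * b)"
  using couple.nrm_interp_le[OF couple_Mn[of n] assms(2,1,3)] assms(4,5)
  by (simp add: nrm_Mn_RC[OF assms(2)] Mn_row_space Mn_col_space)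

lemma functional_le_nrm_RC:
  assumes "\<theta> \<in> {0..1}" "A \<in> carrier_mat n n"
    and "\<And>A B. A \<in> carrier_mat n n \<Longrightarrow> B \<in> carrier_mat n n \<Longrightarrow> \<phi> (A + B) = \<phi> A + \<phi> B"
    and "\<And>c A. A \<in> carrier_mat n n \<Longrightarrow> \<phi> (map_mat (scale_ell2 c) A) = c * \<phi> A"
    and "\<And>A. A \<in> carrier_mat n n \<Longrightarrow> cmod (\<phi> A) \<le> exp a * op_mat_norm (map_mat row_op A)"
    and "\<And>A. A \<in> carrier_mat n n \<Longrightarrow> cmod (\<phi> A) \<le> exp b * op_mat_norm (map_mat col_op A)"
  shows "cmod (\<phi> A) \<le> exp ((1 - \<theta>) * a + \<theta> * b) * nrm (Mn n (RC \<theta>)) A"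
  using couple.functional_le_nrm_interp[where \<phi> = \<phi> and a = a and b = b,
      OF couple_Mn[of n] assms(1,2,3,4)] assms(5,6)
  by (simp add: nrm_Mn_RC[OF assms(2)] Mn_row_space Mn_col_space)

section \<open>Matrices supported on the first row or column\<close>

text \<open>
  The argument \<open>w\<close> is \<open>in_row\<close> or \<open>in_col\<close>, so that one definition covers matrices supported on the
  first row and on the first column. In both cases the two coordinates of \<open>w j\<close> add up to \<open>j\<close>, and
  a position \<open>p\<close> lies on the line exactly if \<open>p = w (fst p + snd p)\<close>.
\<close>

definition line_mat :: "(nat \<Rightarrow> nat \<times> nat) \<Rightarrow> nat \<Rightarrow> (nat \<Rightarrow> ell2) \<Rightarrow> ell2 mat" where
  "line_mat w n v = Matrix.mat n n (\<lambda>p. if p = w (fst p + snd p) then v (fst p + snd p) else 0)"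

definition line_functional ::
    "(nat \<Rightarrow> nat \<times> nat) \<Rightarrow> nat \<Rightarrow> (nat \<Rightarrow> ell2) \<Rightarrow> ell2 mat \<Rightarrow> complex" where
  "line_functional w n u A = (\<Sum>j<n. pairing (A $$ w j) (u j))"

definition in_row :: "nat \<Rightarrow> nat \<times> nat" where "in_row j = (0, j)"

definition in_col :: "nat \<Rightarrow> nat \<times> nat" where "in_col j = (j, 0)"

lemma line_mat_carrier: "line_mat w n v \<in> carrier_mat n n"
  by (simp add: line_mat_def)

lemma row_op_0: "row_op 0 = 0" using norm_row_op[of 0] by simp
lemma col_op_0: "col_op 0 = 0" using norm_col_op[of 0] by simp

lemma op_mat_norm_in_row_le:
  fixes h :: "ell2 \<Rightarrow> (ell2 \<Rightarrow>\<^sub>L ell2)"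
  assumes h0: "h 0 = 0" and b: "0 \<le> b"
    and le: "\<And>\<xi>. L2_set (\<lambda>j. norm (\<xi> j)) {..<n} \<le> 1 \<Longrightarrow> norm (\<Sum>j<n. h (v j) (\<xi> j)) \<le> b"
  shows "op_mat_norm (map_mat h (line_mat in_row n v)) \<le> b"
proof (rule op_mat_norm_least)
  fix \<xi> :: "nat \<Rightarrow> ell2"
  assume "L2_set (\<lambda>j. norm (\<xi> j)) {..<dim_col (map_mat h (line_mat in_row n v))} \<le> 1"
  then have \<xi>: "L2_set (\<lambda>j. norm (\<xi> j)) {..<n} \<le> 1" by (simp add: line_mat_def)
  let ?r = "\<lambda>i. norm (\<Sum>j<n. (map_mat h (line_mat in_row n v) $$ (i, j)) (\<xi> j))"
  have rest: "?r i = 0" if "i < n" "i \<noteq> 0" for i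
    using that by (simp add: line_mat_def in_row_def h0)
  have "L2_set ?r {..<n} \<le> b"
  proof (cases "n = 0")
    case False
    then have "{..<n} = insert 0 {1..<n}" by auto
    moreover have "L2_set ?r {1..<n} = 0" by (rule L2_set_0') (use rest in auto)
    moreover have "?r 0 = norm (\<Sum>j<n. h (v j) (\<xi> j))"
      using False by (simp add: line_mat_def in_row_def)
    ultimately show ?thesis using le[OF \<xi>] by simp
  qed (use b in simp)
  then show "L2_set (\<lambda>i. norm (\<Sum>j<dim_col (map_mat h (line_mat in_row n v)).
      (map_mat h (line_mat in_row n v) $$ (i, j)) (\<xi> j)))
      {..<dim_row (map_mat h (line_mat in_row n v))} \<le> b" by (simp add: line_mat_def)
qed

lemma op_mat_norm_in_col_le:
  fixes h :: "ell2 \<Rightarrow> (ell2 \<Rightarrow>\<^sub>L ell2)"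
  assumes h0: "h 0 = 0" and n: "n \<ge> 1"
    and le: "\<And>x. norm x \<le> 1 \<Longrightarrow> L2_set (\<lambda>i. norm (h (v i) x)) {..<n} \<le> b"
  shows "op_mat_norm (map_mat h (line_mat in_col n v)) \<le> b"
proof (rule op_mat_norm_least)
  fix \<xi> :: "nat \<Rightarrow> ell2"
  assume "L2_set (\<lambda>j. norm (\<xi> j)) {..<dim_col (map_mat h (line_mat in_col n v))} \<le> 1"
  then have \<xi>: "L2_set (\<lambda>j. norm (\<xi> j)) {..<n} \<le> 1" by (simp add: line_mat_def)
  have x: "norm (\<xi> 0) \<le> 1"
    using member_le_L2_set[of "{..<n}" 0 "\<lambda>j. norm (\<xi> j)"] \<xi> n by simp
  have "(\<Sum>j<n. (map_mat h (line_mat in_col n v) $$ (i, j)) (\<xi> j)) = h (v i) (\<xi> 0)" if "i < n" for i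
  proof -
    have "(\<Sum>j<n. (map_mat h (line_mat in_col n v) $$ (i, j)) (\<xi> j))
        = (\<Sum>j\<in>{0}. (map_mat h (line_mat in_col n v) $$ (i, j)) (\<xi> j))"
      using n that by (intro sum.mono_neutral_right) (auto simp: line_mat_def in_col_def h0)
    then show ?thesis using n that by (simp add: line_mat_def in_col_def)
  qed
  then have "L2_set (\<lambda>i. norm (\<Sum>j<n. (map_mat h (line_mat in_col n v) $$ (i, j)) (\<xi> j))) {..<n}
      = L2_set (\<lambda>i. norm (h (v i) (\<xi> 0))) {..<n}"
    by (intro L2_set_cong refl) simp
  then show "L2_set (\<lambda>i. norm (\<Sum>j<dim_col (map_mat h (line_mat in_col n v)).
      (map_mat h (line_mat in_col n v) $$ (i, j)) (\<xi> j)))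
      {..<dim_row (map_mat h (line_mat in_col n v))} \<le> b"
    using le[OF x] by (simp add: line_mat_def)
qed

lemma norm_sum_scale_basis:
  "norm (\<Sum>j<n. scale_ell2 (c j) (basis_ell2 j)) = L2_set (\<lambda>j. cmod (c j)) {..<n}"
proof -
  define S where "S = (\<Sum>j<n. scale_ell2 (c j) (basis_ell2 j))"
  have S: "coord S i = (if i < n then c i else 0)" for i
    unfolding S_def by (induction n)
      (auto simp: zero_ell2.rep_eq plus_ell2.rep_eq scale_ell2.rep_eq basis_ell2.rep_eq less_Suc_eq)
  have "(\<Sum>k. (cmod (coord S k))\<^sup>2) = (\<Sum>k<n. (cmod (coord S k))\<^sup>2)"
    by (rule suminf_finite) (auto simp: S)
  then show ?thesis unfolding S_def[symmetric] by (simp add: norm_ell2_eq S L2_set_def)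
qed

lemma L2_set_coord_le_norm: "L2_set (\<lambda>j. cmod (coord x j)) {..<n} \<le> norm x"
  unfolding L2_set_def norm_ell2_eq
  by (intro real_sqrt_le_mono sum_le_suminf square_summable_coord) auto

lemma sum_le_sqrt_L2_set: "(\<Sum>j<n. \<bar>f j\<bar>) \<le> sqrt (real n) * L2_set f {..<n}"
  using L2_set_mult_ineq[of "\<lambda>_. 1" f "{..<n}"] by (simp add: L2_set_constant)

text \<open>
  The line filled with the first \<open>n\<close> basis vectors: as a row it has norm \<open>sqrt n\<close> over \<open>R\<close> and 1
  over \<open>C\<close>, as a column it has norm 1 over \<open>R\<close> and \<open>sqrt n\<close> over \<open>C\<close>. The four upper bounds follow.
\<close>

lemma row_norm_row_basis: "op_mat_norm (map_mat row_op (line_mat in_row n basis_ell2)) \<le> sqrt n"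
proof (rule op_mat_norm_in_row_le[where h = row_op, OF row_op_0])
  fix \<xi> :: "nat \<Rightarrow> ell2" assume \<xi>: "L2_set (\<lambda>j. norm (\<xi> j)) {..<n} \<le> 1"
  have "norm (\<Sum>j<n. row_op (basis_ell2 j) (\<xi> j)) \<le> (\<Sum>j<n. \<bar>norm (\<xi> j)\<bar>)"
    by (rule sum_norm_le) (simp add: norm_row_op_apply pairing_basis_left cmod_coord_le)
  also have "\<dots> \<le> sqrt n * L2_set (\<lambda>j. norm (\<xi> j)) {..<n}" by (rule sum_le_sqrt_L2_set)
  also have "\<dots> \<le> sqrt n * 1" by (intro mult_left_mono \<xi>) simp
  finally show "norm (\<Sum>j<n. row_op (basis_ell2 j) (\<xi> j)) \<le> sqrt n" by simp
qed simp

lemma col_norm_row_basis: "op_mat_norm (map_mat col_op (line_mat in_row n basis_ell2)) \<le> 1"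
proof (rule op_mat_norm_in_row_le[where h = col_op, OF col_op_0])
  fix \<xi> :: "nat \<Rightarrow> ell2" assume \<xi>: "L2_set (\<lambda>j. norm (\<xi> j)) {..<n} \<le> 1"
  have "norm (\<Sum>j<n. col_op (basis_ell2 j) (\<xi> j)) = L2_set (\<lambda>j. cmod (coord (\<xi> j) 0)) {..<n}"
    by (simp add: col_op_apply norm_sum_scale_basis)
  also have "\<dots> \<le> L2_set (\<lambda>j. norm (\<xi> j)) {..<n}" by (intro L2_set_mono) (auto simp: cmod_coord_le)
  finally show "norm (\<Sum>j<n. col_op (basis_ell2 j) (\<xi> j)) \<le> 1" using \<xi> by simp
qed simp

lemma row_norm_col_basis:
  assumes "n \<ge> 1" shows "op_mat_norm (map_mat row_op (line_mat in_col n basis_ell2)) \<le> 1"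
proof (rule op_mat_norm_in_col_le[where h = row_op, OF row_op_0 assms])
  fix x :: ell2 assume "norm x \<le> 1"
  then show "L2_set (\<lambda>i. norm (row_op (basis_ell2 i) x)) {..<n} \<le> 1"
    using L2_set_coord_le_norm[of x n] by (simp add: norm_row_op_apply pairing_basis_left)
qed

lemma col_norm_col_basis:
  assumes "n \<ge> 1" shows "op_mat_norm (map_mat col_op (line_mat in_col n basis_ell2)) \<le> sqrt n"
proof (rule op_mat_norm_in_col_le[where h = col_op, OF col_op_0 assms])
  fix x :: ell2 assume "norm x \<le> 1"
  then have "cmod (coord x 0) \<le> 1" using cmod_coord_le[of x 0] by simp
  then have "sqrt n * cmod (coord x 0) \<le> sqrt n * 1" by (intro mult_left_mono) auto
  then show "L2_set (\<lambda>i. norm (col_op (basis_ell2 i) x)) {..<n} \<le> sqrt n"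
    by (simp add: col_op_apply norm_scale_ell2 norm_basis_ell2 L2_set_constant)
qed

lemma L2_set_single:
  fixes j n :: nat and y :: ell2
  assumes "j < n"
  shows "L2_set (\<lambda>k. norm (if k = j then y else 0)) {..<n} = norm y"
proof -
  have "(\<Sum>k<n. (norm (if k = j then y else 0))\<^sup>2) = (\<Sum>k\<in>{j}. (norm (if k = j then y else 0))\<^sup>2)"
    using assms by (intro sum.mono_neutral_right) auto
  then show ?thesis by (simp add: L2_set_def)
qed

lemma op_entry_le:
  fixes T :: "(ell2 \<Rightarrow>\<^sub>L ell2) mat"
  assumes "i < dim_row T" "j < dim_col T" "norm y \<le> 1"
  shows "norm ((T $$ (i, j)) y) \<le> op_mat_norm T"
proof -
  let ?\<xi> = "\<lambda>k. if k = j then y else 0"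
  have "(\<Sum>k<dim_col T. (T $$ (i, k)) (?\<xi> k)) = (\<Sum>k\<in>{j}. (T $$ (i, k)) (?\<xi> k))"
    using assms by (intro sum.mono_neutral_right) auto
  then show ?thesis using op_mat_norm_row_upper[of ?\<xi> T i] assms by (simp add: L2_set_single)
qed

lemma pairing_entry_le_row_norm:
  assumes "A \<in> carrier_mat n n" "i < n" "j < n" "norm u \<le> 1"
  shows "cmod (pairing (A $$ (i, j)) u) \<le> op_mat_norm (map_mat row_op A)"
  using op_entry_le[of i "map_mat row_op A" j u] assms by (simp add: norm_row_op_apply)

lemma norm_entry_le_col_norm:
  assumes "A \<in> carrier_mat n n" "i < n" "j < n"
  shows "norm (A $$ (i, j)) \<le> op_mat_norm (map_mat col_op A)"
  using op_entry_le[of i "map_mat col_op A" j "basis_ell2 0"] assms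
  by (simp add: col_op_apply norm_basis_ell2 basis_ell2.rep_eq)

lemma cmod_pairing_unit_le: "norm u \<le> 1 \<Longrightarrow> cmod (pairing x u) \<le> norm x"
  using cmod_pairing_le[of x u] mult_left_mono[of "norm u" 1 "norm x"] by (simp add: pairing_def)

lemma pairing_entry_le_col_norm:
  assumes "A \<in> carrier_mat n n" "i < n" "j < n" "norm u \<le> 1"
  shows "cmod (pairing (A $$ (i, j)) u) \<le> op_mat_norm (map_mat col_op A)"
  using cmod_pairing_unit_le[OF assms(4)] norm_entry_le_col_norm[OF assms(1-3)] by (rule order_trans)

lemma line_functional_le_card:
  assumes "\<And>j. j < n \<Longrightarrow> cmod (pairing (A $$ w j) (u j)) \<le> b"
  shows "cmod (line_functional w n u A) \<le> n * b"
  using sum_norm_le[of "{..<n}" "\<lambda>j. pairing (A $$ w j) (u j)" "\<lambda>_. b"] assms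
  by (simp add: line_functional_def)

text \<open>
  Evaluating the row of operators at the vector with entries \<open>u j / sqrt n\<close>, which has norm at most
  1, yields the functional divided by \<open>sqrt n\<close>.
\<close>

lemma row_functional_le_row_norm:
  assumes A: "A \<in> carrier_mat n n" and n: "n \<ge> 1" and u: "\<And>j. norm (u j) \<le> 1"
  shows "cmod (line_functional in_row n u A) \<le> sqrt n * op_mat_norm (map_mat row_op A)"
proof -
  let ?\<xi> = "\<lambda>j. scale_ell2 (1 / sqrt n) (u j)"
  have "L2_set (\<lambda>j. norm (?\<xi> j)) {..<n} \<le> L2_set (\<lambda>j. 1 / sqrt n) {..<n}"
    using u by (intro L2_set_mono) (auto simp: norm_scale_ell2 norm_divide divide_right_mono)
  also have "\<dots> = 1" using n by (simp add: L2_set_constant)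
  finally have "norm (\<Sum>j<n. row_op (A $$ (0, j)) (?\<xi> j)) \<le> op_mat_norm (map_mat row_op A)"
    using op_mat_norm_row_upper[of ?\<xi> "map_mat row_op A" 0] A n by simp
  moreover have "(\<Sum>j<n. row_op (A $$ (0, j)) (?\<xi> j))
      = scale_ell2 (line_functional in_row n u A / sqrt n) (basis_ell2 0)"
    by (simp add: row_op_pairing pairing_scale_right line_functional_def in_row_def
        sum_divide_distrib flip: ell2.scale_sum_left)
  ultimately show ?thesis using n
    by (simp add: norm_scale_ell2 norm_basis_ell2 norm_divide field_simps)
qed

text \<open>
  Over \<open>C\<close> the norm of a matrix dominates the Hilbert sum of its first column, since this column is
  what the matrix makes of the first basis vector in the first component; Cauchy-Schwarz does the rest.
\<close>

lemma col_functional_le_col_norm: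
  assumes A: "A \<in> carrier_mat n n" and n: "n \<ge> 1" and u: "\<And>j. norm (u j) \<le> 1"
  shows "cmod (line_functional in_col n u A) \<le> sqrt n * op_mat_norm (map_mat col_op A)"
proof -
  have "(\<Sum>k<n. (col_op (A $$ (i, k))) (if k = 0 then basis_ell2 0 else 0)) = A $$ (i, 0)" for i
  proof -
    have "(\<Sum>k<n. (col_op (A $$ (i, k))) (if k = 0 then basis_ell2 0 else 0))
        = (\<Sum>k\<in>{0}. (col_op (A $$ (i, k))) (if k = 0 then basis_ell2 0 else 0))"
      using n by (intro sum.mono_neutral_right) auto
    then show ?thesis by (simp add: col_op_apply basis_ell2.rep_eq)
  qed
  then have L2: "L2_set (\<lambda>i. norm (A $$ (i, 0))) {..<n} \<le> op_mat_norm (map_mat col_op A)"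
    using op_mat_norm_upper[of "\<lambda>k. if k = 0 then basis_ell2 0 else 0" "map_mat col_op A"] A n
    by (simp add: L2_set_single norm_basis_ell2 cong: L2_set_cong_simp)
  have "cmod (line_functional in_col n u A) \<le> (\<Sum>j<n. \<bar>norm (A $$ (j, 0))\<bar>)"
    unfolding line_functional_def by (rule sum_norm_le) (simp add: in_col_def cmod_pairing_unit_le u)
  also have "\<dots> \<le> sqrt n * L2_set (\<lambda>j. norm (A $$ (j, 0))) {..<n}" by (rule sum_le_sqrt_L2_set)
  also have "\<dots> \<le> sqrt n * op_mat_norm (map_mat col_op A)" by (intro mult_left_mono L2) simp
  finally show ?thesis .
qed

lemma line_functional_add:
  assumes w: "\<And>j. fst (w j) + snd (w j) = j" and "A \<in> carrier_mat n n" "B \<in> carrier_mat n n"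
  shows "line_functional w n u (A + B) = line_functional w n u A + line_functional w n u B"
proof -
  have "fst (w j) < n" "snd (w j) < n" if "j < n" for j using w[of j] that by auto
  then have "(A + B) $$ w j = A $$ w j + B $$ w j" if "j < n" for j
    using that assms(2,3) by (cases "w j") fastforce
  then show ?thesis by (simp add: line_functional_def pairing_add_left sum.distrib)
qed

lemma line_functional_scale:
  assumes w: "\<And>j. fst (w j) + snd (w j) = j" and "A \<in> carrier_mat n n"
  shows "line_functional w n u (map_mat (scale_ell2 c) A) = c * line_functional w n u A"
proof -
  have "fst (w j) < n" "snd (w j) < n" if "j < n" for j using w[of j] that by auto
  then have "map_mat (scale_ell2 c) A $$ w j = scale_ell2 c (A $$ w j)" if "j < n" for j
    using that assms(2) by (cases "w j") fastforce
  then show ?thesis by (simp add: line_functional_def pairing_scale_left sum_distrib_left)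
qed

lemma line_functional_diff:
  assumes w: "\<And>j. fst (w j) + snd (w j) = j" and "A \<in> carrier_mat n n" "B \<in> carrier_mat n n"
  shows "line_functional w n u (A - B) = line_functional w n u A - line_functional w n u B"
proof -
  have "(A - B) + B = A" using assms(2,3) by (intro eq_matI) auto
  then show ?thesis using line_functional_add[OF w minus_carrier_mat[OF assms(3)] assms(3), of u A] by simp
qed

lemma exp_ln_combination:
  assumes "n \<ge> 1" shows "exp ((1 - \<theta>) * (p * ln (real n)) + \<theta> * (q * ln (real n)))
    = real n powr ((1 - \<theta>) * p + \<theta> * q)"
  using assms by (simp add: powr_def algebra_simps)

lemma exp_half_ln: "n \<ge> 1 \<Longrightarrow> exp (1/2 * ln (real n)) = sqrt n"
  by (simp add: powr_half_sqrt[symmetric] powr_def)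

lemma nrm_scaled_basis_le:
  assumes \<theta>: "\<theta> \<in> {0..1}" and n: "n \<ge> 1"
    and R: "op_mat_norm (map_mat row_op E) \<le> exp (p * ln (real n))"
    and C: "op_mat_norm (map_mat col_op E) \<le> exp (q * ln (real n))"
    and E: "E \<in> carrier_mat n n"
  shows "nrm (Mn n (RC \<theta>)) (map_mat (scale_ell2 c) E)
    \<le> exp 1 * cmod c * real n powr ((1 - \<theta>) * p + \<theta> * q)"
  unfolding exp_ln_combination[OF n, symmetric]
proof (rule nrm_RC_le[OF \<theta>])
  interpret couple "\<lambda>c. map_mat (scale_ell2 c)" "carrier_mat n n" "Mn n row_space" "Mn n col_space"
    by (rule couple_Mn)
  show "map_mat (scale_ell2 c) E \<in> carrier_mat n n" using E by simp
  show "op_mat_norm (map_mat row_op (map_mat (scale_ell2 c) E)) \<le> cmod c * exp (p * ln (real n))"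
    using X.scale_le[OF E, of c] mult_left_mono[OF R, of "cmod c"] by (simp add: Mn_row_space)
  show "op_mat_norm (map_mat col_op (map_mat (scale_ell2 c) E)) \<le> cmod c * exp (q * ln (real n))"
    using Y.scale_le[OF E, of c] mult_left_mono[OF C, of "cmod c"] by (simp add: Mn_col_space)
qed simp

text \<open>
  Interpolation between the exponents \<open>1/2\<close> and \<open>0\<close>, respectively \<open>0\<close> and \<open>1/2\<close> for columns.
\<close>

lemma nrm_row_basis_le:
  assumes "\<theta> \<in> {0..1}" "n \<ge> 1"
  shows "nrm (Mn n (RC \<theta>)) (map_mat (scale_ell2 c) (line_mat in_row n basis_ell2))
    \<le> exp 1 * cmod c * real n powr ((1 - \<theta>) / 2)"
  using nrm_scaled_basis_le[OF assms, of "line_mat in_row n basis_ell2" "1/2" 0 c]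
    row_norm_row_basis[of n] col_norm_row_basis[of n] exp_half_ln[OF assms(2)]
  by (simp add: line_mat_carrier)

lemma nrm_col_basis_le:
  assumes "\<theta> \<in> {0..1}" "n \<ge> 1"
  shows "nrm (Mn n (RC \<theta>)) (map_mat (scale_ell2 c) (line_mat in_col n basis_ell2))
    \<le> exp 1 * cmod c * real n powr (\<theta> / 2)"
  using nrm_scaled_basis_le[OF assms, of "line_mat in_col n basis_ell2" 0 "1/2" c]
    row_norm_col_basis[OF assms(2)] col_norm_col_basis[OF assms(2)] exp_half_ln[OF assms(2)]
  by (simp add: line_mat_carrier)

lemma in_row_sum: "fst (in_row j) + snd (in_row j) = j" by (simp add: in_row_def)
lemma in_col_sum: "fst (in_col j) + snd (in_col j) = j" by (simp add: in_col_def)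

text \<open>
  The trivial bound \<open>n\<close> for the functional over \<open>C\<close> suffices, because a row of \<open>n\<close> vectors of norm at
  least 1, orthogonal or not, has norm at least a multiple of \<open>n powr ((1 - \<theta>) / 2)\<close>; for columns the
  roles of \<open>R\<close> and \<open>C\<close> are exchanged.
\<close>

lemma row_functional_le:
  assumes "\<theta> \<in> {0..1}" "n \<ge> 1" "A \<in> carrier_mat n n" and u: "\<And>j. norm (u j) \<le> 1"
  shows "cmod (line_functional in_row n u A) \<le> real n powr (1 - (1 - \<theta>) / 2) * nrm (Mn n (RC \<theta>)) A"
proof -
  have "cmod (line_functional in_row n u A)
      \<le> exp ((1 - \<theta>) * (1/2 * ln (real n)) + \<theta> * (1 * ln (real n))) * nrm (Mn n (RC \<theta>)) A"
  proof (rule functional_le_nrm_RC[OF assms(1,3)])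
    fix A :: "ell2 mat" assume A: "A \<in> carrier_mat n n"
    show "cmod (line_functional in_row n u A) \<le> exp (1/2 * ln (real n)) * op_mat_norm (map_mat row_op A)"
      unfolding exp_half_ln[OF assms(2)] by (rule row_functional_le_row_norm[OF A assms(2) u])
    show "cmod (line_functional in_row n u A) \<le> exp (1 * ln (real n)) * op_mat_norm (map_mat col_op A)"
      using line_functional_le_card[of n A in_row u] pairing_entry_le_col_norm[OF A] assms(2) u
      by (simp add: in_row_def)
  qed (simp_all add: line_functional_add line_functional_scale in_row_sum)
  also have "exp ((1 - \<theta>) * (1/2 * ln (real n)) + \<theta> * (1 * ln (real n))) = real n powr (1 - (1 - \<theta>) / 2)"
    unfolding exp_ln_combination[OF assms(2)] by (rule arg_cong[where f = "\<lambda>x. _ powr x"]) (simp add: field_simps)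
  finally show ?thesis .
qed

lemma col_functional_le:
  assumes "\<theta> \<in> {0..1}" "n \<ge> 1" "A \<in> carrier_mat n n" and u: "\<And>j. norm (u j) \<le> 1"
  shows "cmod (line_functional in_col n u A) \<le> real n powr (1 - \<theta> / 2) * nrm (Mn n (RC \<theta>)) A"
proof -
  have "cmod (line_functional in_col n u A)
      \<le> exp ((1 - \<theta>) * (1 * ln (real n)) + \<theta> * (1/2 * ln (real n))) * nrm (Mn n (RC \<theta>)) A"
  proof (rule functional_le_nrm_RC[OF assms(1,3)])
    fix A :: "ell2 mat" assume A: "A \<in> carrier_mat n n"
    show "cmod (line_functional in_col n u A) \<le> exp (1/2 * ln (real n)) * op_mat_norm (map_mat col_op A)"
      unfolding exp_half_ln[OF assms(2)] by (rule col_functional_le_col_norm[OF A assms(2) u])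
    show "cmod (line_functional in_col n u A) \<le> exp (1 * ln (real n)) * op_mat_norm (map_mat row_op A)"
      using line_functional_le_card[of n A in_col u] pairing_entry_le_row_norm[OF A] assms(2) u
      by (simp add: in_col_def)
  qed (simp_all add: line_functional_add line_functional_scale in_col_sum)
  also have "exp ((1 - \<theta>) * (1 * ln (real n)) + \<theta> * (1/2 * ln (real n))) = real n powr (1 - \<theta> / 2)"
    unfolding exp_ln_combination[OF assms(2)] by (rule arg_cong[where f = "\<lambda>x. _ powr x"]) (simp add: field_simps)
  finally show ?thesis .
qed

text \<open>
  Matrices with one nonzero entry transfer the compression estimate of the amplified map to the
  map itself, up to the factor \<open>exp 1\<close>.
\<close>

definition single_mat :: "nat \<Rightarrow> ell2 \<Rightarrow> ell2 mat" where
  "single_mat n y = line_mat in_row n (\<lambda>j. if j = 0 then y else 0)"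

lemma single_mat_carrier: "single_mat n y \<in> carrier_mat n n"
  by (simp add: single_mat_def line_mat_carrier)

lemma single_mat_index:
  "i < n \<Longrightarrow> j < n \<Longrightarrow> single_mat n y $$ (i, j) = (if i = 0 \<and> j = 0 then y else 0)"
  by (auto simp: single_mat_def line_mat_def in_row_def)

lemma op_mat_norm_single_le:
  fixes h :: "ell2 \<Rightarrow> (ell2 \<Rightarrow>\<^sub>L ell2)"
  assumes h: "\<And>x. norm (h x) = norm x" and n: "n \<ge> 1"
  shows "op_mat_norm (map_mat h (single_mat n y)) \<le> norm y"
  unfolding single_mat_def
proof (rule op_mat_norm_in_row_le)
  show h0: "h 0 = 0" using h[of 0] by simp
  fix \<xi> :: "nat \<Rightarrow> ell2" assume \<xi>: "L2_set (\<lambda>j. norm (\<xi> j)) {..<n} \<le> 1"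
  have "(\<Sum>j<n. h (if j = 0 then y else 0) (\<xi> j)) = (\<Sum>j\<in>{0}. h (if j = 0 then y else 0) (\<xi> j))"
    using n by (intro sum.mono_neutral_right) (auto simp: h0)
  then have "norm (\<Sum>j<n. h (if j = 0 then y else 0) (\<xi> j)) \<le> norm (h y) * norm (\<xi> 0)"
    by (simp add: norm_blinfun)
  also have "\<dots> \<le> norm (h y) * 1"
    using member_le_L2_set[of "{..<n}" 0 "\<lambda>j. norm (\<xi> j)"] \<xi> n by (intro mult_left_mono) auto
  finally show "norm (\<Sum>j<n. h (if j = 0 then y else 0) (\<xi> j)) \<le> norm y" by (simp add: h)
qed simp

lemma nrm_single_le:
  assumes "\<theta> \<in> {0..1}" "n \<ge> 1"
  shows "nrm (Mn n (RC \<theta>)) (single_mat n y) \<le> exp 1 * norm y"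
  using nrm_RC_le[OF assms(1) single_mat_carrier, of "norm y" n y 0 0]
    op_mat_norm_single_le[OF norm_row_op assms(2)] op_mat_norm_single_le[OF norm_col_op assms(2)]
  by simp

lemma norm_le_nrm_single:
  assumes "\<theta> \<in> {0..1}" "n \<ge> 1"
  shows "norm y \<le> nrm (Mn n (RC \<theta>)) (single_mat n y)"
proof -
  obtain u where u: "norm u \<le> 1" "pairing y u = norm y" using norming_vector by blast
  have "cmod (pairing (single_mat n y $$ (0, 0)) u)
      \<le> exp ((1 - \<theta>) * 0 + \<theta> * 0) * nrm (Mn n (RC \<theta>)) (single_mat n y)"
    using assms(2) u pairing_entry_le_row_norm[of _ n 0 0 u] pairing_entry_le_col_norm[of _ n 0 0 u]
    by (intro functional_le_nrm_RC[OF assms(1) single_mat_carrier])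
      (simp_all add: pairing_add_left pairing_scale_left)
  then show ?thesis using u assms(2) by (simp add: single_mat_index)
qed

lemma line_index_less:
  fixes w :: "nat \<Rightarrow> nat \<times> nat"
  assumes "\<And>j. fst (w j) + snd (w j) = j" "j < n"
  shows "fst (w j) < n" "snd (w j) < n"
  using assms(1)[of j] assms(2) by linarith+

lemma line_mat_index:
  assumes w: "\<And>j. fst (w j) + snd (w j) = j" and j: "j < n"
  shows "line_mat w n v $$ w j = v j"
proof -
  obtain a b where ab: "w j = (a, b)" by fastforce
  then have "a + b = j" using w[of j] by simp
  then show ?thesis using j ab by (auto simp: line_mat_def)
qed

section \<open>The obstruction to coarse embeddings\<close>

text \<open>
  The consequences of coarseness that the argument uses: steps of length 1 are not stretched beyond
  a constant, and points at distance \<open>L\<close> stay more than \<open>exp 1\<close> apart. The value \<open>exp 1\<close> compensates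
  the constant in the upper bound for matrices with one entry.
\<close>

lemma uniform_bounds_of_equi_coarse_embedding:
  assumes "equi_coarse_embedding A d B d' F"
  obtains M L where "0 \<le> M" "1 \<le> L"
    "\<And>n x y. n \<ge> 1 \<Longrightarrow> x \<in> A n \<Longrightarrow> y \<in> A n \<Longrightarrow> d n x y \<le> 1 \<Longrightarrow> d' n (F n x) (F n y) \<le> M"
    "\<And>n x y. n \<ge> 1 \<Longrightarrow> x \<in> A n \<Longrightarrow> y \<in> A n \<Longrightarrow> L \<le> d n x y \<Longrightarrow> exp 1 < d' n (F n x) (F n y)"
proof -
  have "expansion_modulus A d d' F 1 < \<infinity>"
    using assms by (simp add: equi_coarse_embedding_def)
  then obtain M where M: "0 \<le> M" "expansion_modulus A d d' F 1 = ennreal M"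
    by (cases "expansion_modulus A d d' F 1") auto
  have upper: "d' n (F n x) (F n y) \<le> M" if "n \<ge> 1" "x \<in> A n" "y \<in> A n" "d n x y \<le> 1" for n x y
  proof -
    have "ennreal (d' n (F n x) (F n y)) \<le> expansion_modulus A d d' F 1"
      unfolding expansion_modulus_def using that by (intro SUP_upper2[of n] Sup_upper) auto
    then show ?thesis using M by simp
  qed
  have "(compression_modulus A d d' F \<longlongrightarrow> \<infinity>) at_top"
    using assms by (simp add: equi_coarse_embedding_def)
  then have "\<forall>\<^sub>F t in at_top. ennreal (exp 1) < compression_modulus A d d' F t"
    by (rule order_tendstoD(1)) simp
  then have "\<forall>\<^sub>F t in at_top. ennreal (exp 1) < compression_modulus A d d' F t \<and> 1 \<le> t"
    using eventually_ge_at_top by (rule eventually_conj)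
  then obtain L where L: "ennreal (exp 1) < compression_modulus A d d' F L" "1 \<le> L"
    using eventually_happens by force
  have "exp 1 < d' n (F n x) (F n y)" if "n \<ge> 1" "x \<in> A n" "y \<in> A n" "L \<le> d n x y" for n x y
  proof -
    have "compression_modulus A d d' F L \<le> ennreal (d' n (F n x) (F n y))"
      unfolding compression_modulus_def using that by (intro INF_lower2[of n] Inf_lower) auto
    with L(1) have "ennreal (exp 1) < ennreal (d' n (F n x) (F n y))" by (rule less_le_trans)
    then show ?thesis by (simp add: ennreal_less_iff)
  qed
  with M(1) L(2) upper show ?thesis using that by blast
qed

text \<open>
  In the source the line of length \<open>n\<close> through the vectors \<open>L e\<^sub>j\<close> has norm of order at most
  \<open>n powr s\<close>, hence it is joined to 0 inside the ball by \<open>K\<close> steps of length at most 1 with \<open>K\<close> of the same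
  order. In the target, the difference of the images of the end points has \<open>n\<close> entries of norm at
  least 1, so a suitable functional takes a value of size at least \<open>n\<close> on it. Telescoping along the
  steps bounds this value by a multiple of \<open>n powr s * n powr (1 - q)\<close>, which is too small for
  large \<open>n\<close>.
\<close>

lemma no_embedding_if_lines_stretch:
  fixes s q \<theta> \<gamma> :: real
  assumes \<theta>: "\<theta> \<in> {0..1}" and \<gamma>: "\<gamma> \<in> {0..1}"
    and w: "\<And>j. fst (w j) + snd (w j) = j"
    and s: "0 \<le> s" "s \<le> 1/2" "s < q"
    and source: "\<And>n c. n \<ge> 1 \<Longrightarrow>
      nrm (Mn n (RC \<theta>)) (map_mat (scale_ell2 c) (line_mat w n basis_ell2)) \<le> exp 1 * cmod c * real n powr s"
    and target: "\<And>n u A. n \<ge> 1 \<Longrightarrow> A \<in> carrier_mat n n \<Longrightarrow> (\<And>j. norm (u j) \<le> 1) \<Longrightarrow>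
      cmod (line_functional w n u A) \<le> real n powr (1 - q) * nrm (Mn n (RC \<gamma>)) A"
  shows "\<not> bounded_subsets_almost_completely_coarsely_embed (RC \<theta>) (RC \<gamma>)"
proof
  assume "bounded_subsets_almost_completely_coarsely_embed (RC \<theta>) (RC \<gamma>)"
  then obtain f where emb: "equi_coarse_embedding
      (\<lambda>n. closed_ball (Mn n (RC \<theta>)) (real n)) (\<lambda>n. ndist (Mn n (RC \<theta>)))
      (\<lambda>n. carr (Mn n (RC \<gamma>))) (\<lambda>n. ndist (Mn n (RC \<gamma>))) (\<lambda>n. map_mat (f n))"
    unfolding bounded_subsets_almost_completely_coarsely_embed_def by blast
  obtain M L where M: "0 \<le> M" and L: "1 \<le> L"
    and expand: "\<And>n A B. n \<ge> 1 \<Longrightarrow> A \<in> closed_ball (Mn n (RC \<theta>)) n \<Longrightarrow> B \<in> closed_ball (Mn n (RC \<theta>)) n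
      \<Longrightarrow> nrm (Mn n (RC \<theta>)) (A - B) \<le> 1 \<Longrightarrow> nrm (Mn n (RC \<gamma>)) (map_mat (f n) A - map_mat (f n) B) \<le> M"
    and compress: "\<And>n A B. n \<ge> 1 \<Longrightarrow> A \<in> closed_ball (Mn n (RC \<theta>)) n \<Longrightarrow> B \<in> closed_ball (Mn n (RC \<theta>)) n
      \<Longrightarrow> L \<le> nrm (Mn n (RC \<theta>)) (A - B) \<Longrightarrow> exp 1 < nrm (Mn n (RC \<gamma>)) (map_mat (f n) A - map_mat (f n) B)"
    using uniform_bounds_of_equi_coarse_embedding[OF emb] unfolding ndist_def by metis
  have "filterlim (\<lambda>n. real n powr (q - s)) at_top sequentially"
    using s(3) by real_asymp
  then have "\<forall>\<^sub>F n in sequentially. (exp 1 * L + 1) * M < real n powr (q - s)"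
    by (simp add: filterlim_at_top_dense)
  moreover have "\<forall>\<^sub>F n in sequentially. (exp 1 * L)\<^sup>2 \<le> real n"
    using filterlim_real_sequentially by (simp add: filterlim_at_top)
  ultimately have "\<forall>\<^sub>F n in sequentially. (exp 1 * L + 1) * M < real n powr (q - s) \<and> (exp 1 * L)\<^sup>2 \<le> real n \<and> 1 \<le> n"
    using eventually_ge_at_top[of 1] by eventually_elim simp
  then obtain n where n: "(exp 1 * L + 1) * M < real n powr (q - s)" "(exp 1 * L)\<^sup>2 \<le> real n" "1 \<le> n"
    using eventually_happens trivial_limit_sequentially by blast
  \<comment> \<open>As \<open>s \<le> 1/2\<close>, the second condition on \<open>n\<close> keeps the whole segment in the ball of radius \<open>n\<close>.\<close>
  have sqrt_n: "exp 1 * L \<le> sqrt n" using n(2) L by (simp add: real_le_rsqrt)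
  have n1: "1 \<le> real n" using n(3) by simp
  have ns: "1 \<le> real n powr s" using n1 s(1) by (simp add: ge_one_powr_ge_zero)
  define E where "E = line_mat w n basis_ell2"
  define x where "x c = map_mat (scale_ell2 (complex_of_real c)) E" for c
  have x_carrier: "x c \<in> carrier_mat n n" for c by (simp add: x_def E_def line_mat_carrier)
  have x_index: "x c $$ w j = scale_ell2 c (basis_ell2 j)" if "j < n" for c j
  proof -
    have "x c $$ (fst (w j), snd (w j)) = scale_ell2 c (E $$ (fst (w j), snd (w j)))"
      using line_index_less[of w, OF w that] unfolding x_def
      by (intro index_map_mat) (simp_all add: E_def line_mat_def)
    then show ?thesis by (simp add: E_def line_mat_index[of w, OF w that])
  qed
  have x_diff: "x a - x b = x (a - b)" for a b
    by (intro eq_matI) (auto simp: x_def E_def ell2.scale_left_diff_distrib line_mat_def)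
  have x_nrm: "nrm (Mn n (RC \<theta>)) (x c) \<le> exp 1 * c * real n powr s" if "0 \<le> c" for c
    using source[OF n(3), of "complex_of_real c"] that by (simp add: x_def E_def)
  have x_ball: "x c \<in> closed_ball (Mn n (RC \<theta>)) n" if "0 \<le> c" "c \<le> L" for c
  proof -
    have "exp 1 * c * real n powr s \<le> sqrt n * real n powr (1/2)"
      using that s(2) n1 sqrt_n
      by (intro mult_mono powr_mono order_trans[OF _ sqrt_n]) auto
    also have "\<dots> = n" by (simp add: powr_half_sqrt)
    finally show ?thesis using x_nrm[OF that(1)] x_carrier
      by (simp add: closed_ball_def carr_Mn_RC[OF \<theta>])
  qed
  \<comment> \<open>The entries of the difference of the images of \<open>x L\<close> and \<open>x 0\<close>.\<close>
  define y where "y j = f n (scale_ell2 L (basis_ell2 j)) - f n 0" for j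
  have y_large: "1 \<le> norm (y j)" for j
  proof -
    let ?v = "scale_ell2 L (basis_ell2 j)"
    have v: "norm ?v = L" using L by (simp add: norm_scale_ell2 norm_basis_ell2)
    have "exp 1 * L \<le> real n"
      using sqrt_n real_sqrt_le_iff[of n "n\<^sup>2"] n1 by (simp add: power2_eq_square real_le_lsqrt order_trans)
    then have "single_mat n ?v \<in> closed_ball (Mn n (RC \<theta>)) n"
      using nrm_single_le[OF \<theta> n(3), of ?v] v single_mat_carrier
      by (simp add: closed_ball_def carr_Mn_RC[OF \<theta>])
    moreover have "single_mat n 0 \<in> closed_ball (Mn n (RC \<theta>)) n"
      using nrm_single_le[OF \<theta> n(3), of 0] n1 single_mat_carrier
      by (simp add: closed_ball_def carr_Mn_RC[OF \<theta>])
    moreover have "single_mat n ?v - single_mat n 0 = single_mat n ?v"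
      by (intro eq_matI) (auto simp: single_mat_index single_mat_carrier[THEN carrier_matD(1)]
          single_mat_carrier[THEN carrier_matD(2)])
    moreover have "L \<le> nrm (Mn n (RC \<theta>)) (single_mat n ?v)"
      using norm_le_nrm_single[OF \<theta> n(3), of ?v] v by simp
    ultimately have "exp 1 < nrm (Mn n (RC \<gamma>))
        (map_mat (f n) (single_mat n ?v) - map_mat (f n) (single_mat n 0))"
      using compress[OF n(3)] by simp
    also have "map_mat (f n) (single_mat n ?v) - map_mat (f n) (single_mat n 0) = single_mat n (y j)"
      by (intro eq_matI) (auto simp: y_def single_mat_index single_mat_carrier[THEN carrier_matD(1)]
          single_mat_carrier[THEN carrier_matD(2)])
    also have "nrm (Mn n (RC \<gamma>)) (single_mat n (y j)) \<le> exp 1 * norm (y j)"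
      by (rule nrm_single_le[OF \<gamma> n(3)])
    finally show ?thesis by simp
  qed
  have "\<forall>j. \<exists>u. norm u \<le> 1 \<and> pairing (y j) u = norm (y j)"
    using norming_vector by blast
  from choice[OF this] obtain u
    where u: "\<And>j. norm (u j) \<le> 1" "\<And>j. pairing (y j) (u j) = norm (y j)" by blast
  define \<phi> where "\<phi> c = line_functional w n u (map_mat (f n) (x c))" for c
  have fx: "map_mat (f n) (x c) \<in> carrier_mat n n" for c using x_carrier by simp
  have \<phi>_diff: "\<phi> a - \<phi> b = line_functional w n u (map_mat (f n) (x a) - map_mat (f n) (x b))" for a b
    unfolding \<phi>_def by (rule line_functional_diff[symmetric, OF w fx fx])
  have lower: "real n \<le> cmod (\<phi> L - \<phi> 0)"
  proof -
    have "(map_mat (f n) (x L) - map_mat (f n) (x 0)) $$ w j = y j" if "j < n" for j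
    proof -
      obtain a b where ab: "w j = (a, b)" by fastforce
      then have "a < n" "b < n" using line_index_less[of w, OF w that] by simp_all
      then have "(map_mat (f n) (x L) - map_mat (f n) (x 0)) $$ (a, b)
          = f n (x L $$ (a, b)) - f n (x 0 $$ (a, b))"
        using x_carrier[of L] x_carrier[of 0] by simp
      then show ?thesis using x_index[OF that] by (simp add: ab y_def)
    qed
    then have "\<phi> L - \<phi> 0 = complex_of_real (\<Sum>j<n. norm (y j))"
      by (simp add: \<phi>_diff line_functional_def u(2))
    moreover have "real n \<le> (\<Sum>j<n. norm (y j))"
      using sum_mono[of "{..<n}" "\<lambda>_. 1" "\<lambda>j. norm (y j)"] y_large by simp
    ultimately show ?thesis by (simp only: norm_of_real)
  qed
  \<comment> \<open>The segment from \<open>x 0\<close> to \<open>x L\<close> is cut into \<open>K\<close> equal steps.\<close>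
  define K where "K = nat \<lceil>exp 1 * L * real n powr s\<rceil>"
  have K_ge: "exp 1 * L * real n powr s \<le> real K" unfolding K_def by linarith
  have "0 < exp 1 * L * real n powr s" using L n1 by simp
  then have K_pos: "0 < real K" using K_ge by linarith
  have "real K \<le> exp 1 * L * real n powr s + 1"
    unfolding K_def using \<open>0 < exp 1 * L * real n powr s\<close> by linarith
  then have K_le: "real K \<le> (exp 1 * L + 1) * real n powr s" using ns by (simp add: algebra_simps)
  define c where "c k = real k * (L / real K)" for k
  have c: "c 0 = 0" "c K = L" using K_pos by (simp_all add: c_def)
  have c_range: "0 \<le> c k" "c k \<le> L" if "k \<le> K" for k
    using that K_pos L by (simp_all add: c_def field_simps)
  have step: "cmod (\<phi> (c (Suc k)) - \<phi> (c k)) \<le> real n powr (1 - q) * M" if "k < K" for k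
  proof -
    have "c (Suc k) - c k = L / real K" by (simp add: c_def algebra_simps add_divide_distrib)
    then have "nrm (Mn n (RC \<theta>)) (x (c (Suc k)) - x (c k)) \<le> exp 1 * (L / real K) * real n powr s"
      using x_nrm[of "L / real K"] L by (simp add: x_diff)
    also have "\<dots> \<le> 1" using K_ge K_pos by (simp add: field_simps)
    finally have "nrm (Mn n (RC \<gamma>)) (map_mat (f n) (x (c (Suc k))) - map_mat (f n) (x (c k))) \<le> M"
      using that by (intro expand n x_ball c_range) auto
    then have "real n powr (1 - q) * nrm (Mn n (RC \<gamma>)) (map_mat (f n) (x (c (Suc k))) - map_mat (f n) (x (c k)))
        \<le> real n powr (1 - q) * M" by (intro mult_left_mono) auto
    then show ?thesis unfolding \<phi>_diff
      using target[OF n(3) minus_carrier_mat[OF fx] u(1)] by (rule order_trans[rotated])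
  qed
  have "\<phi> L - \<phi> 0 = (\<Sum>k<K. \<phi> (c (Suc k)) - \<phi> (c k))"
    using sum_lessThan_telescope[of "\<lambda>k. \<phi> (c k)" K] c by simp
  also have "cmod \<dots> \<le> real K * (real n powr (1 - q) * M)"
    using sum_norm_le[of "{..<K}" "\<lambda>k. \<phi> (c (Suc k)) - \<phi> (c k)" "\<lambda>_. real n powr (1 - q) * M"] step
    by simp
  also have "\<dots> \<le> (exp 1 * L + 1) * real n powr s * (real n powr (1 - q) * M)"
    using M by (intro mult_right_mono K_le) simp
  also have "\<dots> = (exp 1 * L + 1) * M * real n powr (s + (1 - q))"
    by (simp add: powr_add)
  also have "\<dots> < real n powr (q - s) * real n powr (s + (1 - q))"
    using n(1) n1 by (intro mult_strict_right_mono) auto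
  also have "\<dots> = real n" using n1 by (simp flip: powr_add)
  finally show False using lower by simp
qed

theorem theorem1p3:
  fixes \<theta> \<gamma> :: real
  assumes "\<theta> \<in> {0..1}" and "\<gamma> \<in> {0..1}" and "\<theta> \<noteq> \<gamma>"
  shows "\<not> bounded_subsets_almost_completely_coarsely_embed (RC \<theta>) (RC \<gamma>)"
proof (cases "\<gamma> < \<theta>")
  case True
  show ?thesis
  proof (rule no_embedding_if_lines_stretch[OF assms(1,2) in_row_sum])
    show "(1 - \<theta>) / 2 < (1 - \<gamma>) / 2" using True by simp
  qed (use assms nrm_row_basis_le row_functional_le in auto)
next
  case False
  show ?thesis
  proof (rule no_embedding_if_lines_stretch[OF assms(1,2) in_col_sum])
    show "\<theta> / 2 < \<gamma> / 2" using False assms(3) by simp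
  qed (use assms nrm_col_basis_le col_functional_le in auto)
qed

end
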